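(* For every $0<\alpha<2$ there exists a constant $C_\alpha>0$ (depending only on $\alpha$) such that for every integer $N\ge 4$ the set $\mathcal P_N\subset\mathbb S^2$ of $N$ deterministic Diamond points satisfies $$0\le I_\alpha N^2-\sum_{x,y\in\mathcal P_N}|x-y|^\alpha\le C_\alpha N^{1-\alpha/2},$$ where $$I_\alpha=\iint_{\mathbb S^2\times\mathbb S^2}|x-y|^\alpha\,d\sigma(x)\,d\sigma(y)=\frac{2^{\alpha+1}}{\alpha+2}.$$
   Context: $\mathbb S^2$ is the unit sphere in $\mathbb R^3$, $|\cdot|$ is the Euclidean norm, and $\sigma$ is the surface area measure on $\mathbb S^2$ normalized to be a probability measure. The sum runs over all ordered pairs $(x,y)\in\mathcal P_N\times\mathcal P_N$ (diagonal terms are zero). Deterministic Diamond points $\mathcal P_N$, for an integer $N\ge4$: put $M=\lfloor\sqrt{N/4}\rfloor$, $r_j=4j$ for $1\le j<M$, $r_M=N-2\sum_{j=1}^{M-1}r_j$, and $r_{M+j}=r_{M-j}$ for $1\le j<M$ (so $r_1,\dots,r_{2M-1}$ are positive integers with sum $N$). For $1\le j\le 2M-1$ let $$h_j=1-\frac2N\sum_{k=1}^{j-1}r_k-\frac{r_j}{N},\qquad \rho_j=\sqrt{1-h_j^2}.$$ Then $$\mathcal P_N=\Big\{\big(\rho_j\cos\tfrac{2\pi\ell}{r_j},\ \rho_j\sin\tfrac{2\pi\ell}{r_j},\ h_j\big):\ 1\le j\le 2M-1,\ 0\le \ell\le r_j-1\Big\},$$ i.e. on the parallel at height $h_j$ one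 places $r_j$ equally spaced points, one of which has positive first coordinate and zero second coordinate. *)

theory Defs
  imports "HOL-Probability.Probability"
begin

definition S2_chart :: "real \<times> real \<Rightarrow> real^3" where
  "S2_chart p = vector [sin (fst p) * cos (snd p), sin (fst p) * sin (snd p), cos (fst p)]"

definition S2_area_element :: "real \<times> real \<Rightarrow> real" where
  "S2_area_element p =
     norm (cross3 (vector_derivative (\<lambda>s. S2_chart (s, snd p)) (at (fst p)))
                  (vector_derivative (\<lambda>t. S2_chart (fst p, t)) (at (snd p))))"

text \<open>The chart is injective on this domain and covers the sphere except for the two poles,
  which have surface area zero.\<close>

definition S2_chart_domain :: "(real \<times> real) set" where
  "S2_chart_domain = {0<..<pi} \<times> {0..<2*pi}"

definition S2_area :: "(real^3) measure" where
  "S2_area =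
     distr (density lborel (\<lambda>p. ennreal (S2_area_element p) * indicator S2_chart_domain p))
       (restrict_space borel (sphere 0 1)) S2_chart"

definition S2_prob :: "(real^3) measure" where
  "S2_prob = uniform_measure S2_area (sphere 0 1)"

definition mean_distance_power :: "real \<Rightarrow> real" where
  "mean_distance_power \<alpha> = (\<integral>x. (\<integral>y. norm (x - y) powr \<alpha> \<partial>S2_prob) \<partial>S2_prob)"

definition diamond_M :: "nat \<Rightarrow> nat" where
  "diamond_M N = nat \<lfloor>sqrt (real N / 4)\<rfloor>"

text \<open>The subtractions do not truncate for the relevant indices: the first one because
  4 * M^2 is at most N (M = diamond_M N), the second one because j is less than 2 * M.\<close>

definition diamond_r :: "nat \<Rightarrow> nat \<Rightarrow> nat" where
  "diamond_r N j =
     (let M = diamond_M N in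
      if j < M then 4 * j
      else if j = M then N - 2 * (\<Sum>k = 1..<M. 4 * k)
      else 4 * (2 * M - j))"

definition diamond_h :: "nat \<Rightarrow> nat \<Rightarrow> real" where
  "diamond_h N j =
     1 - 2 / real N * (\<Sum>k = 1..<j. real (diamond_r N k)) - real (diamond_r N j) / real N"

definition diamond_rho :: "nat \<Rightarrow> nat \<Rightarrow> real" where
  "diamond_rho N j = sqrt (1 - (diamond_h N j)\<^sup>2)"

definition diamond_point :: "nat \<Rightarrow> nat \<Rightarrow> nat \<Rightarrow> real^3" where
  "diamond_point N j l =
     vector [diamond_rho N j * cos (2 * pi * real l / real (diamond_r N j)),
             diamond_rho N j * sin (2 * pi * real l / real (diamond_r N j)),
             diamond_h N j]"

definition diamond_points :: "nat \<Rightarrow> (real^3) set" where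
  "diamond_points N =
     {diamond_point N j l | j l. j \<in> {1..2 * diamond_M N - 1} \<and> l \<in> {0..<diamond_r N j}}"

lemma vector3_eq: "(vector [a, b, c] :: real^3) = a *\<^sub>R axis 1 1 + b *\<^sub>R axis 2 1 + c *\<^sub>R axis 3 1"
  by (simp add: vec_eq_iff forall_3 vector_3 axis_def)

lemma norm_vector3: "norm (vector [a, b, c] :: real^3) = sqrt (a\<^sup>2 + b\<^sup>2 + c\<^sup>2)"
  by (simp add: norm_vec_def L2_set_def sum_3 vector_3)

lemma norm_S2_chart: "norm (S2_chart p) = 1"
proof -
  have "(sin (fst p) * cos (snd p))\<^sup>2 + (sin (fst p) * sin (snd p))\<^sup>2 + (cos (fst p))\<^sup>2
      = (sin (fst p))\<^sup>2 * ((cos (snd p))\<^sup>2 + (sin (snd p))\<^sup>2) + (cos (fst p))\<^sup>2"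
    by (simp only: power_mult_distrib distrib_left)
  also have "\<dots> = 1" by simp
  finally show ?thesis by (simp add: S2_chart_def norm_vector3)
qed

lemma S2_area_element_eq: "S2_area_element p = \<bar>sin (fst p)\<bar>"
proof -
  obtain s t where p: "p = (s, t)" by (cases p)
  have d1: "vector_derivative (\<lambda>s. S2_chart (s, t)) (at s)
      = vector [cos s * cos t, cos s * sin t, - sin s]"
    unfolding S2_chart_def vector3_eq fst_conv snd_conv
    by (rule vector_derivative_at) (auto intro!: derivative_eq_intros)
  have d2: "vector_derivative (\<lambda>t. S2_chart (s, t)) (at t)
      = vector [- (sin s * sin t), sin s * cos t, 0]"
    unfolding S2_chart_def vector3_eq fst_conv snd_conv
    by (rule vector_derivative_at) (auto intro!: derivative_eq_intros simp: mult.commute)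
  have c: "cross3 (vector [cos s * cos t, cos s * sin t, - sin s])
              (vector [- (sin s * sin t), sin s * cos t, 0]) =
      sin s *\<^sub>R S2_chart (s, t)"
  proof -
    have "cos s * cos t * (sin s * cos t) + cos s * sin t * (sin s * sin t)
        = cos s * sin s * ((cos t)\<^sup>2 + (sin t)\<^sup>2)"
      by (simp only: power2_eq_square algebra_simps)
    also have "\<dots> = sin s * cos s" by simp
    finally show ?thesis
      by (simp add: cross3_def S2_chart_def vec_eq_iff forall_3 vector_3)
  qed
  show ?thesis
    by (simp add: S2_area_element_def p d1 d2 c norm_S2_chart)
qed

lemma S2_chart_measurable [measurable]:
  "S2_chart \<in> measurable borel (restrict_space borel (sphere 0 1))"
proof (rule measurable_restrict_space2)
  show "S2_chart \<in> space borel \<rightarrow> sphere 0 1"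
    by (auto simp: norm_S2_chart)
  show "S2_chart \<in> borel_measurable borel"
    unfolding S2_chart_def vector3_eq
    by (intro borel_measurable_continuous_onI continuous_intros)
qed

lemma S2_area_element_measurable [measurable]: "S2_area_element \<in> borel_measurable borel"
  unfolding S2_area_element_eq[abs_def]
  by (intro borel_measurable_continuous_onI continuous_intros)

lemma S2_chart_domain_measurable [measurable]: "S2_chart_domain \<in> sets borel"
  unfolding S2_chart_domain_def by (intro borel_Times) auto

lemma space_S2_area [simp]: "space S2_area = sphere 0 1"
  and sets_S2_area [measurable_cong]: "sets S2_area = sets (restrict_space borel (sphere 0 1))"
  by (simp_all add: S2_area_def space_restrict_space)

lemma emeasure_S2_area: "emeasure S2_area (sphere 0 1) = ennreal (4 * pi)"
proof -
  let ?D = "density lborel (\<lambda>p. ennreal (S2_area_element p) * indicator S2_chart_domain p)"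
  have "emeasure S2_area (space S2_area) = emeasure ?D (S2_chart -` sphere 0 1 \<inter> space ?D)"
    unfolding space_S2_area unfolding S2_area_def
    by (subst emeasure_distr) (auto simp: sets_restrict_space)
  also have "S2_chart -` sphere 0 1 \<inter> space ?D = UNIV"
    by (auto simp: norm_S2_chart)
  also have "emeasure ?D UNIV
      = (\<integral>\<^sup>+ p. ennreal (S2_area_element p) * indicator S2_chart_domain p \<partial>lborel)"
    by (subst emeasure_density) auto
  also have "\<dots> = (\<integral>\<^sup>+ p. (ennreal (sin (fst p)) * indicator {0<..<pi} (fst p)) *
                        indicator {0..<2*pi} (snd p) \<partial>(lborel \<Otimes>\<^sub>M lborel))"
    unfolding lborel_prod
    by (intro nn_integral_cong)
      (auto simp: S2_area_element_eq S2_chart_domain_def indicator_def sin_ge_zero)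
  also have "\<dots> = (\<integral>\<^sup>+ s. (\<integral>\<^sup>+ t. (ennreal (sin s) * indicator {0<..<pi} s) *
                        indicator {0..<2*pi} t \<partial>lborel) \<partial>lborel)"
    by (subst lborel.nn_integral_fst[symmetric]) (auto intro!: measurable_If)
  also have "\<dots> = (\<integral>\<^sup>+ s. (ennreal (sin s) * indicator {0<..<pi} s) * ennreal (2*pi) \<partial>lborel)"
    by (intro nn_integral_cong, subst nn_integral_cmult) auto
  also have "\<dots> = (\<integral>\<^sup>+ s. ennreal (sin s) * indicator {0<..<pi} s \<partial>lborel) * ennreal (2*pi)"
    by (subst nn_integral_multc) auto
  also have "(\<integral>\<^sup>+ s. ennreal (sin s) * indicator {0<..<pi} s \<partial>lborel)
      = (\<integral>\<^sup>+ s. ennreal (sin s) * indicator {0..pi} s \<partial>lborel)"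
    by (intro nn_integral_cong) (auto simp: indicator_def)
  also have "\<dots> = ennreal (- cos pi - (- cos 0))"
    by (rule nn_integral_FTC_Icc) (auto intro!: derivative_eq_intros sin_ge_zero)
  also have "ennreal (- cos pi - (- cos 0)) * ennreal (2*pi) = ennreal (4*pi)"
    by (simp add: ennreal_mult[symmetric] flip: ennreal_numeral)
  finally show ?thesis by simp
qed

lemma prob_space_S2_prob: "prob_space S2_prob"
  unfolding S2_prob_def
  by (rule prob_space_uniform_measure) (auto simp: emeasure_S2_area)

lemma diamond_M_ge_1: assumes "N \<ge> 4" shows "diamond_M N \<ge> 1"
proof -
  have "1 \<le> sqrt (real N / 4)" using assms by simp
  then have "1 \<le> \<lfloor>sqrt (real N / 4)\<rfloor>" by linarith
  then show ?thesis unfolding diamond_M_def by linarith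
qed

lemma diamond_M_square_le: "4 * (diamond_M N)\<^sup>2 \<le> N"
proof -
  have "real (diamond_M N) \<le> sqrt (real N / 4)" by (simp add: diamond_M_def)
  then have "(real (diamond_M N))\<^sup>2 \<le> (sqrt (real N / 4))\<^sup>2" by (intro power_mono) auto
  then have "real (4 * (diamond_M N)\<^sup>2) \<le> real N" by simp
  then show ?thesis by linarith
qed

lemma sum_cap: "(\<Sum>k = 1..<m. 4 * k) + 2 * m = 2 * m\<^sup>2" for m :: nat
proof (induction m)
  case (Suc m) then show ?case by (cases m) (auto simp: power2_eq_square)
qed simp

lemma twice_sum_cap_less:
  assumes "N \<ge> 4" shows "2 * (\<Sum>k = 1..<diamond_M N. 4 * k) < N"
  using sum_cap[of "diamond_M N"] diamond_M_square_le[of N] diamond_M_ge_1[OF assms] by linarith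

lemma diamond_r_pos:
  assumes "N \<ge> 4" "j \<in> {1..2 * diamond_M N - 1}" shows "diamond_r N j > 0"
  using assms twice_sum_cap_less[OF assms(1)] by (auto simp: diamond_r_def Let_def)

lemma diamond_r_sym:
  assumes "1 \<le> j" "j < diamond_M N"
  shows "diamond_r N (diamond_M N + j) = diamond_r N (diamond_M N - j)"
  using assms by (auto simp: diamond_r_def Let_def)

lemma sum_diamond_r:
  assumes "N \<ge> 4" shows "(\<Sum>j = 1..2 * diamond_M N - 1. diamond_r N j) = N"
proof -
  define m where "m = diamond_M N"
  have m: "m \<ge> 1" using diamond_M_ge_1[OF assms] by (simp add: m_def)
  have "{1..2 * m - 1} = {1..<m} \<union> {m} \<union> {m<..2 * m - 1}" using m by auto
  then have "(\<Sum>j = 1..2 * m - 1. diamond_r N j) =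
     (\<Sum>j = 1..<m. diamond_r N j) + diamond_r N m + (\<Sum>j\<in>{m<..2 * m - 1}. diamond_r N j)"
    by (simp only:, subst sum.union_disjoint, auto simp: sum.union_disjoint)
  also have "(\<Sum>j = 1..<m. diamond_r N j) = (\<Sum>k = 1..<m. 4 * k)"
    by (rule sum.cong) (auto simp: diamond_r_def m_def Let_def)
  also have "(\<Sum>j\<in>{m<..2 * m - 1}. diamond_r N j) = (\<Sum>k = 1..<m. 4 * k)"
    by (rule sum.reindex_bij_witness[of _ "\<lambda>k. 2 * m - k" "\<lambda>j. 2 * m - j"])
       (auto simp: diamond_r_def m_def Let_def)
  also have "diamond_r N m = N - 2 * (\<Sum>k = 1..<m. 4 * k)"
    by (simp add: diamond_r_def m_def)
  finally show ?thesis using twice_sum_cap_less[OF assms] by (simp add: m_def)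
qed

lemma diamond_h_bound:
  assumes "N \<ge> 4" "j \<in> {1..2 * diamond_M N - 1}" shows "\<bar>diamond_h N j\<bar> < 1"
proof -
  have pos: "diamond_r N j > 0" using diamond_r_pos assms by blast
  have "(\<Sum>k = 1..<j. diamond_r N k) + diamond_r N j = (\<Sum>k = 1..j. diamond_r N k)"
    using assms(2) by (simp add: sum.last_plus atLeastLessThanSuc_atLeastAtMost[symmetric])
  also have "\<dots> \<le> (\<Sum>k = 1..2 * diamond_M N - 1. diamond_r N k)"
    using assms(2) by (intro sum_mono2) auto
  finally have "(\<Sum>k = 1..<j. diamond_r N k) + diamond_r N j \<le> N"
    using sum_diamond_r[OF assms(1)] by simp
  then have "2 * real (\<Sum>k = 1..<j. diamond_r N k) + real (diamond_r N j) < 2 * real N"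
    using pos by linarith
  moreover have "0 < 2 * real (\<Sum>k = 1..<j. diamond_r N k) + real (diamond_r N j)"
    using pos by linarith
  moreover have "diamond_h N j =
      1 - (2 * real (\<Sum>k = 1..<j. diamond_r N k) + real (diamond_r N j)) / real N"
    by (simp add: diamond_h_def add_divide_distrib)
  moreover have "0 < x / real N \<and> x / real N < 2" if "0 < x" "x < 2 * real N" for x
    using that assms(1) by (simp add: divide_less_eq)
  ultimately show ?thesis by (smt (verit))
qed

lemma diamond_h_less:
  assumes "N \<ge> 4" "i \<in> {1..2 * diamond_M N - 1}" "j \<in> {1..2 * diamond_M N - 1}" "i < j"
  shows "diamond_h N j < diamond_h N i"
proof -
  have pos: "diamond_r N i > 0" "diamond_r N j > 0" using diamond_r_pos assms by blast+
  have "(\<Sum>k = 1..<i. diamond_r N k) + diamond_r N i = (\<Sum>k = 1..i. diamond_r N k)"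
    using assms(2) by (simp add: sum.last_plus atLeastLessThanSuc_atLeastAtMost[symmetric])
  also have "\<dots> \<le> (\<Sum>k = 1..<j. diamond_r N k)"
    using assms(4) by (intro sum_mono2) auto
  finally have "2 * real (\<Sum>k = 1..<i. diamond_r N k) + real (diamond_r N i)
      < 2 * real (\<Sum>k = 1..<j. diamond_r N k) + real (diamond_r N j)"
    using pos by linarith
  moreover have "diamond_h N k =
      1 - (2 * real (\<Sum>i = 1..<k. diamond_r N i) + real (diamond_r N k)) / real N" for k
    by (simp add: diamond_h_def add_divide_distrib)
  ultimately show ?thesis using assms(1) by (simp add: divide_strict_right_mono)
qed

lemma diamond_points_subset_sphere:
  assumes "N \<ge> 4" shows "diamond_points N \<subseteq> sphere 0 1"
proof -
  have "norm (diamond_point N j l) = 1" if "j \<in> {1..2 * diamond_M N - 1}" for j l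
  proof -
    let ?t = "2 * pi * real l / real (diamond_r N j)"
    have "(diamond_h N j)\<^sup>2 \<le> 1"
      using diamond_h_bound[OF assms that] by (simp add: abs_square_le_1)
    then have "(diamond_rho N j)\<^sup>2 = 1 - (diamond_h N j)\<^sup>2" by (simp add: diamond_rho_def)
    moreover have "(diamond_rho N j * cos ?t)\<^sup>2 + (diamond_rho N j * sin ?t)\<^sup>2
        = (diamond_rho N j)\<^sup>2 * ((cos ?t)\<^sup>2 + (sin ?t)\<^sup>2)"
      by (simp only: power_mult_distrib algebra_simps)
    ultimately show ?thesis by (simp add: diamond_point_def norm_vector3)
  qed
  then show ?thesis by (auto simp: diamond_points_def)
qed

lemma card_diamond_points:
  assumes "N \<ge> 4" shows "card (diamond_points N) = N"
proof -
  define J where "J = {1..2 * diamond_M N - 1}"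
  have inj: "inj_on (\<lambda>(j, l). diamond_point N j l) (SIGMA j:J. {0..<diamond_r N j})"
  proof (rule inj_onI, clarsimp)
    fix i k j l
    assume i: "i \<in> J" and k: "k < diamond_r N i" and j: "j \<in> J" and l: "l < diamond_r N j"
      and eq: "diamond_point N i k = diamond_point N j l"
    have "diamond_h N i = diamond_h N j"
      using arg_cong[OF eq, of "\<lambda>v. v $ 3"] by (simp add: diamond_point_def vector_3)
    then have ij: "i = j"
      using diamond_h_less[OF assms, of i j] diamond_h_less[OF assms, of j i] i j
      by (metis J_def less_irrefl linorder_neqE_nat)
    let ?r = "real (diamond_r N j)"
    have "\<bar>diamond_h N j\<bar> < 1" using diamond_h_bound assms j J_def by blast
    then have "diamond_rho N j \<noteq> 0"
      by (auto simp: diamond_rho_def power2_eq_1_iff)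
    then have "cos (2 * pi * real k / ?r) = cos (2 * pi * real l / ?r)"
      "sin (2 * pi * real k / ?r) = sin (2 * pi * real l / ?r)"
      using arg_cong[OF eq, of "\<lambda>v. v $ 1"] arg_cong[OF eq, of "\<lambda>v. v $ 2"]
      by (simp_all add: diamond_point_def vector_3 ij)
    then obtain n :: int where "2 * pi * real k / ?r = 2 * pi * real l / ?r + 2 * pi * n"
      using sin_cos_eq_iff by metis
    then have "pi * (2 * (real k - real l - n * ?r)) = 0"
      using l by (simp add: field_simps)
    then have n: "real k - real l = n * ?r" by simp
    have "\<bar>real k - real l\<bar> < 1 * ?r" using k l unfolding ij by linarith
    then have "\<bar>n * ?r\<bar> < 1 * ?r" unfolding n .
    then have "\<bar>real_of_int n\<bar> < 1" using l by (simp add: abs_mult)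
    then have "n = 0" by linarith
    then show "i = j \<and> k = l" using n ij by simp
  qed
  have "diamond_points N = (\<lambda>(j, l). diamond_point N j l) ` (SIGMA j:J. {0..<diamond_r N j})"
    by (auto simp: diamond_points_def J_def image_iff) blast+
  then have "card (diamond_points N) = card (SIGMA j:J. {0..<diamond_r N j})"
    using card_image[OF inj] by simp
  also have "\<dots> = (\<Sum>j\<in>J. diamond_r N j)" by (simp add: J_def card_SigmaI)
  finally show ?thesis using sum_diamond_r[OF assms] by (simp add: J_def)
qed

end

theory Submission
  imports Defs
begin

text \<open>
  Write \<open>b = \<alpha> / 2\<close>. Since \<open>r powr \<alpha>\<close> is a positive multiple of the integral of
  \<open>(1 - exp (- t r^2)) t^(-1-b)\<close> over \<open>t > 0\<close>, the energy deficit is the same multiple of the integral of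
  \<open>E t * t^(-1-b)\<close>, where \<open>E t\<close> is the deficit of the Gaussian kernel \<open>exp (- t |x - y|^2)\<close>.
  Being a convolution square, this kernel gives \<open>E t \<ge> 0\<close>, with \<open>E t\<close> proportional to the squared
  \<open>L^2\<close>-norm over \<open>\<real>^3\<close> of the discrepancy \<open>\<Sum>x. f x z - N * \<integral> f y z d\<sigma>(y)\<close>, \<open>f x z = exp (- 2 t |x - z|^2)\<close>.
  It suffices to show \<open>E t \<le> C t\<close> for \<open>t \<le> N\<close>: for \<open>t \<ge> N\<close> monotonicity of the kernel then gives
  \<open>E t \<le> (C + 1) N\<close>, and both ranges of \<open>t\<close> contribute \<open>O(N powr (1 - b))\<close>.

  For this, cut the sphere into coordinate rectangles of area \<open>1/N\<close> and diameter \<open>O(N^(-1/2))\<close> around the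
  points. The mean of the height over a rectangle is the height of its point (Archimedes), so the centroid of the
  rectangle at a point of distance \<open>\<rho>\<close> from the axis is only \<open>O(1 / (N \<rho>))\<close> away from the point. Expanding \<open>f\<close>
  to second order, the contribution of such a rectangle to the discrepancy is at most a constant times
  \<open>(t / N + sqrt t / (N \<rho>)) exp (- t |x - z|^2)\<close>, and the \<open>L^2\<close>-norm of the sum is computed term by term.
\<close>

section \<open>Gaussian integrals\<close>

lemma nn_integral_gaussian_real:
  fixes c :: real assumes "c > 0"
  shows "(\<integral>\<^sup>+x. ennreal (exp (- c * x\<^sup>2)) \<partial>lborel) = ennreal (sqrt (pi / c))"
proof -
  \<comment> \<open>The standard deviation for which the normal density is a multiple of
    \<open>exp (- c * x^2)\<close>.\<close>
  define d where "d = sqrt (1 / (2 * c))"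
  have d: "d > 0" "d\<^sup>2 = 1 / (2 * c)" using assms by (auto simp: d_def)
  have e: "exp (- c * x\<^sup>2) = sqrt (pi / c) * normal_density 0 d x" for x
    using assms by (simp add: normal_density_def d(2) field_simps real_sqrt_divide)
  have "integrable lborel (\<lambda>x. exp (- c * x\<^sup>2))" "(\<integral>x. exp (- c * x\<^sup>2) \<partial>lborel) = sqrt (pi / c)"
    unfolding e using d by (auto simp: integrable_normal_density integral_normal_density)
  then show ?thesis by (subst nn_integral_eq_integral) auto
qed

text \<open>The squared norm is a sum over coordinates, so the integral splits into one-dimensional
  ones.\<close>

lemma has_bochner_integral_gaussian:
  fixes c :: real assumes "c > 0"
  shows "has_bochner_integral lborel (\<lambda>z :: 'a::euclidean_space. exp (- c * (norm z)\<^sup>2))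
           (sqrt (pi / c) ^ DIM('a))"
proof (rule has_bochner_integral_nn_integral)
  have "(\<integral>\<^sup>+(z::'a). ennreal (exp (- c * (norm z)\<^sup>2)) \<partial>lborel)
      = (\<integral>\<^sup>+(z::'a). ennreal (\<Prod>b\<in>Basis. exp (- c * (z \<bullet> b)\<^sup>2)) \<partial>lborel)"
  proof (rule nn_integral_cong)
    fix z :: 'a
    have "(norm z)\<^sup>2 = (\<Sum>b\<in>Basis. (z \<bullet> b)\<^sup>2)"
      unfolding power2_norm_eq_inner by (subst euclidean_inner) (simp add: power2_eq_square)
    then show "ennreal (exp (- c * (norm z)\<^sup>2)) = ennreal (\<Prod>b\<in>Basis. exp (- c * (z \<bullet> b)\<^sup>2))"
      by (simp add: sum_distrib_left flip: exp_sum)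
  qed
  also have "\<dots> = (\<Prod>b\<in>(Basis :: 'a set). \<integral>\<^sup>+x. ennreal (exp (- c * x\<^sup>2)) \<partial>lborel)"
    by (subst nn_integral_lborel_prod[symmetric]) (simp_all add: prod_ennreal)
  also have "\<dots> = ennreal (sqrt (pi / c) ^ DIM('a))"
    by (subst nn_integral_gaussian_real[OF assms]) (use assms in \<open>simp add: ennreal_power\<close>)
  finally show "(\<integral>\<^sup>+(z::'a). ennreal (exp (- c * (norm z)\<^sup>2)) \<partial>lborel) = ennreal (sqrt (pi / c) ^ DIM('a))" .
qed (use assms in auto)

text \<open>The parallelogram law around the midpoint \<open>m\<close> splits the product into a
  factor free of \<open>z\<close> and a Gaussian centred at \<open>m\<close>. This exhibits the
  Gaussian kernel as a convolution square.\<close>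

lemma has_bochner_integral_gaussian_mult:
  fixes c :: real and x y :: "'a::euclidean_space" assumes "c > 0"
  shows "has_bochner_integral lborel
           (\<lambda>z. exp (- c * (norm (x - z))\<^sup>2) * exp (- c * (norm (y - z))\<^sup>2))
           (exp (- (c / 2) * (norm (x - y))\<^sup>2) * sqrt (pi / (2 * c)) ^ DIM('a))"
proof -
  define m where "m = (1/2) *\<^sub>R (x + y)"
  have eq: "exp (- c * (norm (x - z))\<^sup>2) * exp (- c * (norm (y - z))\<^sup>2) =
      exp (- (c / 2) * (norm (x - y))\<^sup>2) * exp (- (2 * c) * (norm (- m + z))\<^sup>2)" for z
  proof -
    have "(norm (x - z))\<^sup>2 + (norm (y - z))\<^sup>2 = 2 * (norm (- m + z))\<^sup>2 + (norm (x - y))\<^sup>2 / 2"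
      by (simp add: power2_norm_eq_inner m_def inner_diff_left inner_diff_right inner_add_left
          inner_add_right inner_commute field_simps)
    then have "- c * (norm (x - z))\<^sup>2 + - c * (norm (y - z))\<^sup>2
       = - (c / 2) * (norm (x - y))\<^sup>2 + - (2 * c) * (norm (- m + z))\<^sup>2"
      by (simp add: algebra_simps flip: distrib_left)
    then show ?thesis by (simp only: flip: exp_add)
  qed
  have "has_bochner_integral (distr lborel borel ((+) (- m)))
      (\<lambda>z. exp (- (2 * c) * (norm z)\<^sup>2)) (sqrt (pi / (2 * c)) ^ DIM('a))"
    unfolding lborel_distr_plus using has_bochner_integral_gaussian[of "2 * c"] assms by simp
  then have "has_bochner_integral lborel
      (\<lambda>z. exp (- (2 * c) * (norm (- m + z))\<^sup>2)) (sqrt (pi / (2 * c)) ^ DIM('a))"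
    by (auto simp: has_bochner_integral_iff integrable_distr_eq integral_distr)
  then show ?thesis unfolding eq by (intro has_bochner_integral_mult_right) auto
qed

section \<open>Integration over the sphere\<close>

lemma continuous_on_S2_chart: "continuous_on A S2_chart"
  unfolding S2_chart_def vector3_eq by (intro continuous_intros)

lemma continuous_on_S2_chart_compose [continuous_intros]:
  "continuous_on A f \<Longrightarrow> continuous_on A (\<lambda>x. S2_chart (f x))"
  by (rule continuous_on_compose2[OF continuous_on_S2_chart]) auto

lemma sets_S2_prob [measurable_cong]: "sets S2_prob = sets (restrict_space borel (sphere 0 1))"
  and space_S2_prob [simp]: "space S2_prob = sphere 0 1"
  by (simp_all add: S2_prob_def sets_S2_area)

lemma borel_measurable_S2_prob:
  "g \<in> borel_measurable borel \<Longrightarrow> g \<in> borel_measurable S2_prob"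
  unfolding measurable_cong_sets[OF sets_S2_prob refl] by (rule measurable_restrict_space1)

lemma continuous_on_UNIV_bounded_sphere:
  fixes g :: "real^3 \<Rightarrow> real" assumes "continuous_on UNIV g"
  obtains B where "\<And>x. x \<in> sphere 0 1 \<Longrightarrow> \<bar>g x\<bar> \<le> B"
proof -
  have "compact (g ` sphere 0 1)"
    by (intro compact_continuous_image continuous_on_subset[OF assms]) auto
  then obtain B where "\<And>y. y \<in> g ` sphere 0 1 \<Longrightarrow> norm y \<le> B"
    using compact_imp_bounded bounded_iff by metis
  then show ?thesis by (intro that[of B]) auto
qed

lemma integrable_S2_prob:
  fixes g :: "real^3 \<Rightarrow> real" assumes "continuous_on UNIV g"
  shows "integrable S2_prob g"
proof -
  interpret prob_space S2_prob by (rule prob_space_S2_prob)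
  obtain B where "\<And>x. x \<in> sphere 0 1 \<Longrightarrow> \<bar>g x\<bar> \<le> B"
    using continuous_on_UNIV_bounded_sphere[OF assms] by blast
  then show ?thesis
    by (intro integrable_const_bound[where B = B] AE_I2)
       (auto intro: borel_measurable_S2_prob borel_measurable_continuous_onI assms)
qed

text \<open>Passes from the image measure to a gauge integral over a closed box, where continuity
  gives iterated integration and the fundamental theorem applies. The divisor is the area
  \<open>4 * pi\<close>.\<close>

lemma integral_S2_prob:
  fixes g :: "real^3 \<Rightarrow> real" assumes g: "continuous_on UNIV g"
  shows "(\<integral>x. g x \<partial>S2_prob) =
    integral (cbox (0, 0) (pi, 2 * pi)) (\<lambda>p. g (S2_chart p) * sin (fst p)) / (4 * pi)"
proof -
  have [measurable]: "g \<in> borel_measurable borel"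
    by (rule borel_measurable_continuous_onI[OF g])
  have gr [measurable]: "g \<in> borel_measurable S2_area"
    unfolding measurable_cong_sets[OF sets_S2_area refl] by (rule measurable_restrict_space1) simp
  have [measurable]: "(\<lambda>p. g (S2_chart p)) \<in> borel_measurable borel"
    "(\<lambda>p :: real \<times> real. sin (fst p)) \<in> borel_measurable borel"
    by (intro borel_measurable_continuous_onI continuous_intros continuous_on_compose2[OF g] subset_UNIV)+
  have [measurable]: "sphere 0 1 \<in> sets S2_area"
    using sets.top[of S2_area] by simp
  have nn: "0 \<le> S2_area_element p" for p by (simp add: S2_area_element_eq)
  have eq: "S2_prob = density S2_area (\<lambda>x. ennreal (1 / (4 * pi)))"
    unfolding S2_prob_def uniform_measure_def emeasure_S2_area
    by (intro density_cong)
       (auto simp: divide_ennreal[symmetric] intro!: AE_I2)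
  have "(\<integral>x. g x \<partial>S2_prob) = (\<integral>x. (1 / (4 * pi)) * g x \<partial>S2_area)"
    unfolding eq by (subst integral_density) auto
  also have "\<dots> = (\<integral>x. g x \<partial>S2_area) / (4 * pi)" by simp
  also have "(\<integral>x. g x \<partial>S2_area) = (\<integral>p. g (S2_chart p)
     \<partial>density lborel (\<lambda>p. ennreal (S2_area_element p * indicator S2_chart_domain p)))"
    unfolding S2_area_def by (subst integral_distr)
      (auto simp: ennreal_mult' ennreal_indicator nn intro: measurable_restrict_space1)
  also have "\<dots> = (\<integral>p. S2_area_element p * indicator S2_chart_domain p * g (S2_chart p) \<partial>lborel)"
    by (subst integral_density) (auto simp: nn intro!: measurable_compose[OF _ \<open>g \<in> borel_measurable borel\<close>])
  also have "\<dots> = (\<integral>p. indicator (cbox (0, 0) (pi, 2 * pi)) p *\<^sub>R (g (S2_chart p) * sin (fst p)) \<partial>lborel)"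
  proof (rule integral_cong_AE)
    \<comment> \<open>The chart domain and the closed box differ only in pieces of axis-parallel
      lines, which are null sets.\<close>
    have ae: "AE p in lborel. p \<bullet> k \<noteq> c" if "k \<in> Basis" for k :: "real \<times> real" and c :: real
    proof -
      have "{p. p \<bullet> k = c} \<in> null_sets lborel"
        using negligible_standard_hyperplane[OF that, of c]
        by (subst null_sets_completion_iff[symmetric])
           (auto simp: negligible_iff_null_sets intro!: borel_closed closed_Collect_eq continuous_intros)
      from AE_not_in[OF this] show ?thesis by simp
    qed
    have "AE p :: real \<times> real in lborel. fst p \<noteq> c"
      "AE p :: real \<times> real in lborel. snd p \<noteq> c" for c :: real
      using ae[of "(1, 0)" c] ae[of "(0, 1)" c] by (simp_all add: Basis_prod_def inner_prod_def)
    note 1 = this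
    show "AE p in lborel. S2_area_element p * indicator S2_chart_domain p * g (S2_chart p) =
      indicator (cbox (0, 0) (pi, 2 * pi)) p *\<^sub>R (g (S2_chart p) * sin (fst p))"
      using 1(1)[of pi] 1(1)[of 0] 1(2)[of "2 * pi"]
    proof eventually_elim
      case (elim p)
      then show ?case
        by (cases p) (auto simp: S2_area_element_eq S2_chart_domain_def indicator_def sin_ge_zero cbox_Pair_eq)
    qed
  qed measurable
  also have "\<dots> = integral (cbox (0, 0) (pi, 2 * pi)) (\<lambda>p. g (S2_chart p) * sin (fst p))"
    unfolding set_lebesgue_integral_def[symmetric]
  proof (rule set_borel_integral_eq_integral(2))
    show "set_integrable lborel (cbox (0, 0) (pi, 2 * pi)) (\<lambda>p. g (S2_chart p) * sin (fst p))"
      unfolding set_integrable_def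
      by (intro borel_integrable_compact compact_cbox continuous_intros continuous_on_compose2[OF g] subset_UNIV)
  qed
  finally show ?thesis by simp
qed

section \<open>Rotation invariance of zonal exponentials\<close>

text \<open>Each summand is integrated first in its own variable; the boundary values left by the
  fundamental theorem cancel. In the application \<open>A\<close> vanishes at both poles and
  \<open>B\<close> is periodic in the azimuth.\<close>

lemma integral_box_divergence_eq_0:
  fixes A B a b :: "real \<times> real \<Rightarrow> real"
  assumes A: "\<And>s t. s \<in> {s0..s1} \<Longrightarrow> t \<in> {t0..t1} \<Longrightarrow> ((\<lambda>s. A (s, t)) has_real_derivative a (s, t)) (at s)"
    and B: "\<And>s t. s \<in> {s0..s1} \<Longrightarrow> t \<in> {t0..t1} \<Longrightarrow> ((\<lambda>t. B (s, t)) has_real_derivative b (s, t)) (at t)"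
    and A0: "\<And>t. A (s0, t) = A (s1, t)" and B0: "\<And>s. B (s, t0) = B (s, t1)"
    and le: "s0 \<le> s1" "t0 \<le> t1"
    and cont: "continuous_on UNIV a" "continuous_on UNIV b"
  shows "integral (cbox (s0, t0) (s1, t1)) (\<lambda>p. a p + b p) = 0"
proof -
  note ca = continuous_on_subset[OF cont(1) subset_UNIV] and cb = continuous_on_subset[OF cont(2) subset_UNIV]
  have "integral {t0..t1} (\<lambda>t. b (s, t)) = 0" if "s \<in> {s0..s1}" for s
  proof -
    have "((\<lambda>t. b (s, t)) has_integral (B (s, t1) - B (s, t0))) {t0..t1}"
      by (rule fundamental_theorem_of_calculus[OF le(2)])
         (metis B[OF that] has_real_derivative_iff_has_vector_derivative has_vector_derivative_at_within)
    then show ?thesis unfolding B0 by (simp add: integral_unique)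
  qed
  then have "integral {s0..s1} (\<lambda>s. integral {t0..t1} (\<lambda>t. b (s, t))) = integral {s0..s1} (\<lambda>s. 0)"
    by (intro integral_cong)
  then have b: "integral (cbox (s0, t0) (s1, t1)) b = 0"
    unfolding integral_prod_continuous[OF cb] box_real by simp
  have "integral {s0..s1} (\<lambda>s. a (s, t)) = 0" if "t \<in> {t0..t1}" for t
  proof -
    have "((\<lambda>s. a (s, t)) has_integral (A (s1, t) - A (s0, t))) {s0..s1}"
      by (rule fundamental_theorem_of_calculus[OF le(1)])
         (metis A[OF _ that] has_real_derivative_iff_has_vector_derivative has_vector_derivative_at_within)
    then show ?thesis unfolding A0 by (simp add: integral_unique)
  qed
  then have "integral {t0..t1} (\<lambda>t. integral {s0..s1} (\<lambda>s. a (s, t))) = integral {t0..t1} (\<lambda>t. 0)"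
    by (intro integral_cong)
  then have a: "integral (cbox (s0, t0) (s1, t1)) a = 0"
    using integral_swap_continuous[of s0 t0 s1 t1 "\<lambda>s t. a (s, t)"] ca
    unfolding integral_prod_continuous[OF ca] box_real by simp
  have "a integrable_on cbox (s0, t0) (s1, t1)" "b integrable_on cbox (s0, t0) (s1, t1)"
    by (intro integrable_continuous ca cb)+
  from integral_add[OF this] a b show ?thesis by simp
qed

text \<open>The derivative in \<open>\<theta>\<close> is that along a rotation field, which is divergence-free
  with respect to the area form \<open>sin s ds d\<phi>\<close>; so the integrand is a divergence.\<close>

lemma integral_exp_zonal_rotate:
  fixes k \<theta> \<psi> :: real
  shows "integral (cbox (0, 0) (pi, 2 * pi)) (\<lambda>p. exp (k * (sin \<theta> * sin (fst p) * cos (snd p - \<psi>) +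
      cos \<theta> * cos (fst p))) * sin (fst p)) =
    integral (cbox (0, 0) (pi, 2 * pi)) (\<lambda>p. exp (k * cos (fst p)) * sin (fst p))"
proof -
  define U where "U \<theta> p = k * (sin \<theta> * sin (fst p) * cos (snd p - \<psi>) + cos \<theta> * cos (fst p))"
    for \<theta> and p :: "real \<times> real"
  define F where "F \<theta> p = exp (U \<theta> p) * sin (fst p)" for \<theta> p
  define F' where "F' \<theta> p = exp (U \<theta> p) * (k * (cos \<theta> * sin (fst p) * cos (snd p - \<psi>) -
     sin \<theta> * cos (fst p))) * sin (fst p)" for \<theta> p
  have zero: "integral (cbox (0, 0) (pi, 2 * pi)) (F' \<theta>) = 0" for \<theta>
  proof -
    \<comment> \<open>\<open>A\<close> and \<open>B\<close> are \<open>exp U\<close> times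
      \<open>sin s\<close> times the polar and azimuthal components of the rotation field.\<close>
    define A where "A p = - exp (U \<theta> p) * cos (snd p - \<psi>) * sin (fst p)" for p
    define B where "B p = exp (U \<theta> p) * cos (fst p) * sin (snd p - \<psi>)" for p
    define a where "a p = - exp (U \<theta> p) * (k * (sin \<theta> * cos (fst p) * cos (snd p - \<psi>) - cos \<theta> * sin (fst p)))
        * cos (snd p - \<psi>) * sin (fst p) - exp (U \<theta> p) * cos (snd p - \<psi>) * cos (fst p)" for p
    define b where "b p = exp (U \<theta> p) * (k * (- sin \<theta> * sin (fst p) * sin (snd p - \<psi>)))
        * cos (fst p) * sin (snd p - \<psi>) + exp (U \<theta> p) * cos (fst p) * cos (snd p - \<psi>)" for p
    have ab: "integral (cbox (0, 0) (pi, 2 * pi)) (\<lambda>p. a p + b p) = 0"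
    proof (rule integral_box_divergence_eq_0[where A = A and B = B])
      show "((\<lambda>s. A (s, t)) has_real_derivative a (s, t)) (at s)" for s t
        unfolding A_def a_def U_def fst_conv snd_conv
        by (auto intro!: derivative_eq_intros simp: algebra_simps)
      show "((\<lambda>t. B (s, t)) has_real_derivative b (s, t)) (at t)" for s t
        unfolding B_def b_def U_def fst_conv snd_conv
        by (auto intro!: derivative_eq_intros simp: algebra_simps)
      show "B (s, 0) = B (s, 2 * pi)" for s
        using sin_periodic[of "- \<psi>"] cos_periodic[of "- \<psi>"]
        by (simp add: B_def U_def)
    qed (auto simp: A_def a_def b_def U_def intro!: continuous_intros)
    \<comment> \<open>A polynomial identity in the trigonometric values;
      \<open>d\<^sup>2 + c\<^sup>2\<close> is kept together so that it can be replaced by 1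
      afterwards.\<close>
    have alg: "- E * (k * (S * cs * c - C * ss)) * c * ss - E * c * cs +
       (E * (k * (- S * ss * d)) * cs * d + E * cs * c) = E * (k * (C * ss * c - S * cs * (d\<^sup>2 + c\<^sup>2))) * ss"
      for E S C cs ss c d :: real
      by (simp add: algebra_simps power2_eq_square)
    have "a p + b p = F' \<theta> p" for p
    proof -
      have "a p + b p = exp (U \<theta> p) * (k * (cos \<theta> * sin (fst p) * cos (snd p - \<psi>) -
          sin \<theta> * cos (fst p) * ((sin (snd p - \<psi>))\<^sup>2 + (cos (snd p - \<psi>))\<^sup>2))) * sin (fst p)"
        unfolding a_def b_def by (rule alg)
      then show ?thesis by (simp only: F'_def sin_cos_squared_add mult_1_right)
    qed
    with ab show ?thesis by simp
  qed
  \<comment> \<open>As the derivative in \<open>\<theta>\<close> vanishes everywhere,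
    \<open>\<theta>\<close> may be replaced by 0, where the exponent no longer depends on the
    azimuth.\<close>
  have "((\<lambda>\<theta>. integral (cbox (0, 0) (pi, 2 * pi)) (F \<theta>)) has_real_derivative
      integral (cbox (0, 0) (pi, 2 * pi)) (F' \<theta>)) (at \<theta>)" for \<theta>
  proof (rule leibniz_rule_field_derivative[where U = UNIV])
    show "((\<lambda>\<theta>. F \<theta> p) has_real_derivative F' \<theta> p) (at \<theta>)" for \<theta> p
      unfolding F_def F'_def U_def by (auto intro!: derivative_eq_intros simp: algebra_simps)
    show "F \<theta> integrable_on cbox (0, 0) (pi, 2 * pi)" for \<theta>
      unfolding F_def U_def by (intro integrable_continuous continuous_intros)
    show "continuous_on (UNIV \<times> cbox (0, 0) (pi, 2 * pi)) (\<lambda>(x, t). F' x t)"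
      unfolding F'_def U_def split_beta by (intro continuous_intros)
  qed (rule UNIV_I convex_UNIV)+
  from DERIV_isconst_all[OF allI, OF this[unfolded zero]]
  have "integral (cbox (0, 0) (pi, 2 * pi)) (F \<theta>) = integral (cbox (0, 0) (pi, 2 * pi)) (F 0)" .
  then show ?thesis by (simp add: F_def[abs_def] U_def)
qed

text \<open>Covers the poles as well, where the azimuth is arbitrary; the rotation formula thereby
  applies to every centre on the sphere.\<close>

lemma sphere_point_polar:
  fixes x :: "real^3" assumes "norm x = 1"
  obtains \<theta> \<psi> where "x = S2_chart (\<theta>, \<psi>)"
proof -
  have x: "(x $ 1)\<^sup>2 + (x $ 2)\<^sup>2 + (x $ 3)\<^sup>2 = 1"
    using assms by (simp add: norm_vec_def L2_set_def sum_3)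
  define r where "r = sqrt ((x $ 1)\<^sup>2 + (x $ 2)\<^sup>2)"
  have "r\<^sup>2 + (x $ 3)\<^sup>2 = 1" using x by (simp add: r_def)
  then obtain \<theta> where \<theta>: "x $ 3 = cos \<theta>" "r = sin \<theta>"
    using sincos_total_2pi[of "x $ 3" r] by (metis add.commute)
  obtain \<psi> where \<psi>: "x $ 1 = r * cos \<psi>" "x $ 2 = r * sin \<psi>"
  proof (cases "r = 0")
    case True
    then have "x $ 1 = 0" "x $ 2 = 0" by (simp_all add: r_def sum_power2_eq_zero_iff)
    then show ?thesis using that[of 0] True by simp
  next
    case False
    have "(x $ 1)\<^sup>2 + (x $ 2)\<^sup>2 = r\<^sup>2" by (simp add: r_def)
    then have "(x $ 1 / r)\<^sup>2 + (x $ 2 / r)\<^sup>2 = 1"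
      using False by (simp add: power_divide flip: add_divide_distrib)
    then obtain \<psi> where "x $ 1 / r = cos \<psi>" "x $ 2 / r = sin \<psi>"
      using sincos_total_2pi by metis
    then show ?thesis using that[of \<psi>] False by (simp add: field_simps)
  qed
  have "x = S2_chart (\<theta>, \<psi>)"
    using \<theta> \<psi> by (simp add: S2_chart_def vec_eq_iff forall_3 vector_3)
  then show ?thesis by (rule that)
qed

section \<open>Explicit means over the sphere\<close>

lemma norm_diff_sphere:
  fixes x y :: "'a::real_inner" assumes "norm x = 1" "norm y = 1"
  shows "(norm (x - y))\<^sup>2 = 2 - 2 * (x \<bullet> y)"
  using assms by (simp add: power2_norm_eq_inner norm_eq_1 inner_diff_left inner_diff_right inner_commute)

lemma inner_S2_chart:
  "S2_chart (\<theta>, \<psi>) \<bullet> S2_chart p = sin \<theta> * sin (fst p) * cos (snd p - \<psi>) + cos \<theta> * cos (fst p)"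
  by (simp add: S2_chart_def inner_vec_def sum_3 vector_3 cos_diff algebra_simps)

lemma integral_box_polar:
  fixes f :: "real \<Rightarrow> real" assumes "continuous_on UNIV f"
  shows "integral (cbox (0, 0) (pi, 2 * pi)) (\<lambda>p. f (fst p) :: real) = 2 * pi * integral {0..pi} f"
  by (subst integral_prod_continuous)
     (auto intro!: continuous_on_compose2[OF assms] continuous_on_fst continuous_on_id)

text \<open>On the sphere the kernel is \<open>exp (- 2 * t)\<close> times an exponential of the
  inner product. Rotating \<open>x\<close> to the pole leaves an integral in the polar angle with an
  elementary antiderivative.\<close>

lemma integral_S2_prob_gaussian:
  fixes t :: real assumes "t > 0" "norm x = 1"
  shows "(\<integral>y. exp (- t * (norm (x - y))\<^sup>2) \<partial>S2_prob) = (1 - exp (- 4 * t)) / (4 * t)"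
proof -
  obtain \<theta> \<psi> where x: "x = S2_chart (\<theta>, \<psi>)" using sphere_point_polar[OF assms(2)] .
  have "(\<integral>y. exp (- t * (norm (x - y))\<^sup>2) \<partial>S2_prob) =
    integral (cbox (0, 0) (pi, 2 * pi)) (\<lambda>p. exp (- t * (norm (x - S2_chart p))\<^sup>2) * sin (fst p)) / (4 * pi)"
    by (intro integral_S2_prob continuous_intros)
  also have "(\<lambda>p. exp (- t * (norm (x - S2_chart p))\<^sup>2) * sin (fst p)) =
     (\<lambda>p. exp (- 2 * t) * (exp (2 * t * (sin \<theta> * sin (fst p) * cos (snd p - \<psi>) +
      cos \<theta> * cos (fst p))) * sin (fst p)))"
    by (rule ext, subst norm_diff_sphere)
       (auto simp: x norm_S2_chart inner_S2_chart algebra_simps simp flip: exp_add)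
  also have "integral (cbox (0, 0) (pi, 2 * pi)) \<dots> =
      exp (- 2 * t) * (2 * pi * integral {0..pi} (\<lambda>s. exp (2 * t * cos s) * sin s))"
    unfolding integral_mult_right integral_exp_zonal_rotate
    by (subst integral_box_polar) (auto intro!: continuous_intros)
  also have "integral {0..pi} (\<lambda>s. exp (2 * t * cos s) * sin s) =
      - exp (2 * t * cos pi) / (2 * t) - (- exp (2 * t * cos 0) / (2 * t))"
    by (intro integral_unique fundamental_theorem_of_calculus)
       (use assms in \<open>auto simp flip: has_real_derivative_iff_has_vector_derivative
          intro!: derivative_eq_intros\<close>)
  also have "exp (- 2 * t) * (2 * pi * (- exp (2 * t * cos pi) / (2 * t) - (- exp (2 * t * cos 0) / (2 * t)))) / (4 * pi)
     = (exp (- 2 * t) * exp (2 * t) - exp (- 2 * t) * exp (- 2 * t)) / (4 * t)"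
    using assms by (simp add: field_simps)
  also have "\<dots> = (1 - exp (- 4 * t)) / (4 * t)" by (simp flip: exp_add)
  finally show ?thesis .
qed

text \<open>At the pole the integrand depends on the polar angle alone; all other centres are
  reduced to this one in \<open>integral_S2_prob_powr\<close>.\<close>

lemma integral_S2_prob_powr_pole:
  fixes b :: real assumes "b > 0"
  shows "(\<integral>y. ((norm (S2_chart (0, 0) - y))\<^sup>2) powr b \<partial>S2_prob) = 4 powr b / (b + 1)"
proof -
  have "(\<integral>y. ((norm (S2_chart (0, 0) - y))\<^sup>2) powr b \<partial>S2_prob) =
    integral (cbox (0, 0) (pi, 2 * pi)) (\<lambda>p. ((norm (S2_chart (0, 0) - S2_chart p))\<^sup>2) powr b * sin (fst p)) / (4 * pi)"
    using assms by (intro integral_S2_prob continuous_on_powr' continuous_intros) auto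
  also have "(\<lambda>p. ((norm (S2_chart (0, 0) - S2_chart p))\<^sup>2) powr b * sin (fst p)) =
     (\<lambda>p. (2 - 2 * cos (fst p)) powr b * sin (fst p))"
    by (rule ext, subst norm_diff_sphere) (auto simp: norm_S2_chart inner_S2_chart)
  also have "integral (cbox (0, 0) (pi, 2 * pi)) \<dots> = 2 * pi * integral {0..pi} (\<lambda>s. (2 - 2 * cos s) powr b * sin s)"
    using assms by (subst integral_box_polar) (auto intro!: continuous_intros continuous_on_powr')
  also have "integral {0..pi} (\<lambda>s. (2 - 2 * cos s) powr b * sin s) =
      (2 - 2 * cos pi) powr (b + 1) / (2 * (b + 1)) - (2 - 2 * cos 0) powr (b + 1) / (2 * (b + 1))"
  \<comment> \<open>The interior version is used because the chain rule for \<open>powr\<close> asks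
    for a positive base, and \<open>2 - 2 * cos s\<close> vanishes at \<open>s = 0\<close>.\<close>
  proof (intro integral_unique fundamental_theorem_of_calculus_interior)
    fix s :: real assume s: "s \<in> {0<..<pi}"
    then have "cos s < 1"
      using cos_monotone_0_pi[of 0 s] by auto
    have "((\<lambda>s. 2 - 2 * cos s) has_real_derivative 2 * sin s) (at s)"
      by (auto intro!: derivative_eq_intros)
    from DERIV_chain2[OF has_real_derivative_powr[of "2 - 2 * cos s" "b + 1"] this] \<open>cos s < 1\<close>
    have "((\<lambda>s. (2 - 2 * cos s) powr (b + 1)) has_real_derivative
        (b + 1) * (2 - 2 * cos s) powr b * (2 * sin s)) (at s)" by simp
    moreover have "(b + 1) * X * (2 * S) / (2 * (b + 1)) = X * S" for X S :: real
      using assms by (subst nonzero_divide_eq_eq) (auto simp: algebra_simps)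
    ultimately show "((\<lambda>s. (2 - 2 * cos s) powr (b + 1) / (2 * (b + 1))) has_vector_derivative (2 - 2 * cos s) powr b * sin s) (at s)"
      unfolding has_real_derivative_iff_has_vector_derivative[symmetric]
      by (metis DERIV_cdivide)
  qed (use assms in \<open>auto intro!: continuous_intros continuous_on_powr'\<close>)
  also have "2 * pi * ((2 - 2 * cos pi) powr (b + 1) / (2 * (b + 1)) - (2 - 2 * cos 0) powr (b + 1) / (2 * (b + 1))) / (4 * pi)
     = 4 powr b / (b + 1)"
  proof -
    have "8 * X / (8 * b + 8) = X / (b + 1)" for X
      using assms by (subst frac_eq_eq) (auto simp: algebra_simps)
    then show ?thesis by (simp add: powr_add)
  qed
  finally show ?thesis .
qed

section \<open>Subordination of powers to Gaussians\<close>

lemma nn_integral_powr_from_0: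
  fixes e c :: real assumes "e > -1" "c \<ge> 0"
  shows "(\<integral>\<^sup>+t. ennreal (indicator {0..c} t * t powr e) \<partial>lborel) = ennreal (c powr (e + 1) / (e + 1))"
proof (rule nn_integral_has_integral_lborel)
  show "((\<lambda>t. indicator {0..c} t * t powr e) has_integral (c powr (e + 1) / (e + 1))) UNIV"
    using has_integral_powr_from_0[OF assms]
    by (subst (asm) has_integral_restrict_UNIV[symmetric]) (auto simp: indicator_def elim!: back_subst[of "\<lambda>f. (f has_integral _) UNIV"])
qed auto

lemma nn_integral_powr_to_inf:
  fixes e c :: real assumes "e < -1" "c > 0"
  shows "(\<integral>\<^sup>+t. ennreal (indicator {c..} t * t powr e) \<partial>lborel) = ennreal (- (c powr (e + 1)) / (e + 1))"
proof (rule nn_integral_has_integral_lborel)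
  show "((\<lambda>t. indicator {c..} t * t powr e) has_integral (- (c powr (e + 1)) / (e + 1))) UNIV"
    using has_integral_powr_to_inf[OF assms]
    by (subst (asm) has_integral_restrict_UNIV[symmetric]) (auto simp: indicator_def elim!: back_subst[of "\<lambda>f. (f has_integral _) UNIV"])
qed auto

text \<open>\<open>c\<close> is the integral for \<open>a = 1\<close>, and substituting
  \<open>a * t\<close> for \<open>t\<close> produces \<open>a powr b\<close>. For convergence,
  \<open>1 - exp (- t)\<close> is at most \<open>t\<close>, which settles 0 because
  \<open>b < 1\<close>, and at most 1, which settles infinity because \<open>b > 0\<close>.\<close>

lemma powr_subordination:
  fixes b :: real assumes b: "0 < b" "b < 1"
  obtains c :: real where "c > 0" "\<And>a. a \<ge> 0 \<Longrightarrow>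
    has_bochner_integral lborel (\<lambda>t. indicator {0<..} t * ((1 - exp (- t * a)) * t powr (- 1 - b))) (c * a powr b)"
proof -
  define f where "f t = indicator {0<..} t * ((1 - exp (- t)) * t powr (- 1 - b))" for t :: real
  have fnn: "0 \<le> f t" for t by (simp add: f_def indicator_def)
  have [measurable]: "f \<in> borel_measurable borel" unfolding f_def by measurable
  have "f t \<le> indicator {0..1} t * t powr (- b) + indicator {1..} t * t powr (- 1 - b)" for t
  proof (cases "t > 0")
    case True
    have "1 - exp (- t) \<le> t" using exp_ge_add_one_self[of "- t"] by simp
    then have "(1 - exp (- t)) * t powr (- 1 - b) \<le> t * t powr (- 1 - b)"
      by (intro mult_right_mono) auto
    also have "t * t powr (- 1 - b) = t powr (- b)"
      using powr_mult_base[of t "- 1 - b"] True by simp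
    finally have 1: "(1 - exp (- t)) * t powr (- 1 - b) \<le> t powr (- b)" .
    have "(1 - exp (- t)) * t powr (- 1 - b) \<le> 1 * t powr (- 1 - b)"
      by (intro mult_right_mono) auto
    moreover have "- 1 \<le> exp (- t)" by (rule order_trans[OF _ exp_ge_zero]) simp
    ultimately show ?thesis using 1 True by (auto simp: f_def indicator_def)
  qed (simp add: f_def)
  then have "(\<integral>\<^sup>+t. ennreal (f t) \<partial>lborel) \<le>
     (\<integral>\<^sup>+t. ennreal (indicator {0..1} t * t powr (- b)) + ennreal (indicator {1..} t * t powr (- 1 - b)) \<partial>lborel)"
    by (intro nn_integral_mono) (simp flip: ennreal_plus)
  also have "\<dots> < \<infinity>"
    using b by (subst nn_integral_add) (simp_all add: nn_integral_powr_from_0 nn_integral_powr_to_inf)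
  finally have int: "integrable lborel f"
    by (intro integrableI_nonneg) (auto simp: fnn)
  define c where "c = (\<integral>t. f t \<partial>lborel)"
  \<comment> \<open>Positivity of \<open>c\<close>, by comparison with a positive constant on
    \<open>{1..2}\<close>.\<close>
  have "0 < (\<integral>t. indicator {1..2::real} t * ((1 - exp (- 1)) * 2 powr (- 1 - b)) \<partial>lborel)"
    by simp
  also have "\<dots> \<le> c" unfolding c_def
  proof (rule integral_mono[OF _ int])
    show "indicator {1..2} t * ((1 - exp (- 1)) * 2 powr (- 1 - b)) \<le> f t" for t :: real
    proof (cases "t \<in> {1..2}")
      case True
      have "(1 - exp (- 1)) * 2 powr (- 1 - b) \<le> (1 - exp (- t)) * t powr (- 1 - b)"
        using True b by (intro mult_mono powr_mono2') auto
      then show ?thesis using True by (simp add: f_def)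
    qed (simp add: fnn)
  qed simp
  finally have c: "c > 0" .
  have "has_bochner_integral lborel (\<lambda>t. indicator {0<..} t * ((1 - exp (- t * a)) * t powr (- 1 - b))) (c * a powr b)"
    if "a \<ge> 0" for a
  \<comment> \<open>For \<open>a = 0\<close> both the integrand and \<open>0 powr b\<close> vanish;
    the substitution is possible only for \<open>a > 0\<close>.\<close>
  proof (cases "a = 0")
    case False
    then have a: "a > 0" using that by simp
    have "has_bochner_integral lborel f c" using int by (simp add: has_bochner_integral_iff c_def)
    then have "has_bochner_integral lborel (\<lambda>t. f (0 + a * t)) (c /\<^sub>R \<bar>a\<bar>)"
      using lborel_has_bochner_integral_real_affine_iff[of a f c 0] a by simp
    then have "has_bochner_integral lborel (\<lambda>t. a powr (1 + b) * f (0 + a * t)) (a powr (1 + b) * (c /\<^sub>R \<bar>a\<bar>))"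
      by (intro has_bochner_integral_mult_right)
    moreover have eq: "a powr (1 + b) * f (0 + a * t) = indicator {0<..} t * ((1 - exp (- t * a)) * t powr (- 1 - b))" for t
    proof (cases "t > 0")
      case True
      have "a powr (1 + b) * (a * t) powr (- 1 - b) = t powr (- 1 - b)"
        using a True by (simp add: powr_mult flip: powr_add mult.assoc)
      then show ?thesis using True a by (simp add: f_def zero_less_mult_iff mult.commute mult.left_commute)
    qed (use a in \<open>simp add: f_def zero_less_mult_iff\<close>)
    moreover have val: "a powr (1 + b) * (c /\<^sub>R \<bar>a\<bar>) = c * a powr b"
      using a by (simp add: powr_add divide_inverse)
    ultimately show ?thesis by (simp only:)
  qed (auto intro: has_bochner_integral_zero)
  with c show ?thesis by (rule that)
qed

lemma powr_norm_eq: "norm x powr \<alpha> = ((norm x)\<^sup>2) powr (\<alpha> / 2)"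
  by (cases "x = 0") (simp_all add: powr_powr flip: powr_numeral)

section \<open>Spherical means of Gaussians and powers\<close>

text \<open>For \<open>t > 0\<close> this is the mean of \<open>exp (- t |x - y|^2)\<close> over
  \<open>y\<close> on the sphere, the same for every centre \<open>x\<close> on it.\<close>

definition gauss_mean :: "real \<Rightarrow> real" where "gauss_mean t = (1 - exp (- 4 * t)) / (4 * t)"

lemma
  assumes "t > 0"
  shows gauss_mean_nonneg: "0 \<le> gauss_mean t" and gauss_mean_le_1: "gauss_mean t \<le> 1"
    and gauss_mean_le: "gauss_mean t \<le> 1 / (4 * t)"
proof -
  show "0 \<le> gauss_mean t" "gauss_mean t \<le> 1 / (4 * t)"
    using assms by (auto simp: gauss_mean_def divide_right_mono)
  show "gauss_mean t \<le> 1"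
    using assms exp_ge_add_one_self[of "- 4 * t"] by (simp add: gauss_mean_def)
qed

lemma measurable_ident_S2_prob [measurable]: "(\<lambda>y. y) \<in> borel_measurable S2_prob"
  by (rule borel_measurable_S2_prob) simp

text \<open>The subordination formula is averaged over \<open>y\<close> by Tonelli. The average of
  the integrand involves only \<open>gauss_mean t\<close>, hence not \<open>x\<close>, so the mean
  of the power is the same at \<open>x\<close> as at the pole.\<close>

lemma
  fixes b c :: real
  assumes b: "0 < b" and c: "c > 0" and x: "norm x = 1"
    and sub: "\<And>a. a \<ge> 0 \<Longrightarrow>
    has_bochner_integral lborel (\<lambda>t. indicator {0<..} t * ((1 - exp (- t * a)) * t powr (- 1 - b))) (c * a powr b)"
  shows has_bochner_integral_gauss_mean: "has_bochner_integral lborel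
      (\<lambda>t. indicator {0<..} t * ((1 - gauss_mean t) * t powr (- 1 - b))) (c * (4 powr b / (b + 1)))" (is ?T1)
    and integral_S2_prob_powr: "(\<integral>y. ((norm (x - y))\<^sup>2) powr b \<partial>S2_prob) = 4 powr b / (b + 1)" (is ?T2)
proof -
  interpret S: prob_space S2_prob by (rule prob_space_S2_prob)
  interpret pair_sigma_finite lborel S2_prob ..
  define \<phi> where "\<phi> t = indicator {0<..} t * ((1 - gauss_mean t) * t powr (- 1 - b))" for t :: real
  have *: "(\<integral>\<^sup>+t. ennreal (\<phi> t) \<partial>lborel) = ennreal (c * (\<integral>y. ((norm (x - y))\<^sup>2) powr b \<partial>S2_prob))"
    if x: "norm x = 1" for x
  proof -
    define \<Phi> where "\<Phi> t y = indicator {0<..} t * ((1 - exp (- t * (norm (x - y))\<^sup>2)) * t powr (- 1 - b))"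
      for t :: real and y
    have \<Phi>nn: "0 \<le> \<Phi> t y" for t y by (auto simp: \<Phi>_def indicator_def)
    have [measurable]: "(\<lambda>(t, y). \<Phi> t y) \<in> borel_measurable (lborel \<Otimes>\<^sub>M S2_prob)"
      unfolding \<Phi>_def by measurable
    have t: "(\<integral>\<^sup>+y. ennreal (\<Phi> t y) \<partial>S2_prob) = ennreal (\<phi> t)" for t
    proof (cases "t > 0")
      case True
      have int: "integrable S2_prob (\<lambda>y. exp (- t * (norm (x - y))\<^sup>2))"
        by (intro integrable_S2_prob continuous_intros)
      have "(\<integral>y. \<Phi> t y \<partial>S2_prob) = \<phi> t"
        using integral_S2_prob_gaussian[OF True x] int True
        by (simp add: \<Phi>_def \<phi>_def gauss_mean_def S.prob_space[unfolded space_S2_prob])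
      moreover have "integrable S2_prob (\<Phi> t)" unfolding \<Phi>_def
        by (intro integrable_S2_prob continuous_intros)
      ultimately show ?thesis by (subst nn_integral_eq_integral) (auto simp: \<Phi>nn)
    qed (simp add: \<Phi>_def \<phi>_def)
    have y: "(\<integral>\<^sup>+t. ennreal (\<Phi> t y) \<partial>lborel) = ennreal (c * ((norm (x - y))\<^sup>2) powr b)" for y
      using sub[of "(norm (x - y))\<^sup>2"] \<Phi>nn
      by (subst nn_integral_eq_integral) (auto simp: \<Phi>_def has_bochner_integral_iff)
    have "(\<integral>\<^sup>+t. ennreal (\<phi> t) \<partial>lborel) = (\<integral>\<^sup>+y. (\<integral>\<^sup>+t. ennreal (\<Phi> t y) \<partial>lborel) \<partial>S2_prob)"
      unfolding t[symmetric] by (rule Fubini'[symmetric]) measurable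
    also have "\<dots> = ennreal (\<integral>y. c * ((norm (x - y))\<^sup>2) powr b \<partial>S2_prob)"
      unfolding y using b c
      by (intro nn_integral_eq_integral integrable_S2_prob continuous_intros continuous_on_powr' AE_I2) auto
    finally show ?thesis by simp
  qed
  have V: "0 \<le> (\<integral>y. ((norm (x - y))\<^sup>2) powr b \<partial>S2_prob)" for x
    by (rule Bochner_Integration.integral_nonneg) simp
  have pole: "norm (S2_chart (0, 0)) = 1" by (rule norm_S2_chart)
  \<comment> \<open>Both centres give the same integral of \<open>\<phi>\<close>; cancelling
    \<open>c\<close> identifies the two means.\<close>
  from *[OF x] *[OF pole] V[of x] V[of "S2_chart (0, 0)"] c show ?T2
    unfolding integral_S2_prob_powr_pole[OF b, symmetric] by simp
  have "\<phi> t \<ge> 0" for t using gauss_mean_le_1[of t] by (auto simp: \<phi>_def indicator_def)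
  then show ?T1 unfolding \<phi>_def[symmetric]
    using *[OF pole] b c unfolding integral_S2_prob_powr_pole[OF b]
    by (intro has_bochner_integral_nn_integral) (auto simp: \<phi>_def gauss_mean_def)
qed

lemma mean_distance_power_eq:
  assumes "0 < \<alpha>" "\<alpha> < 2"
  shows "mean_distance_power \<alpha> = 4 powr (\<alpha> / 2) / (\<alpha> / 2 + 1)"
proof -
  interpret S: prob_space S2_prob by (rule prob_space_S2_prob)
  obtain c where c: "c > 0" "\<And>a. a \<ge> 0 \<Longrightarrow> has_bochner_integral lborel
     (\<lambda>t. indicator {0<..} t * ((1 - exp (- t * a)) * t powr (- 1 - \<alpha> / 2))) (c * a powr (\<alpha> / 2))"
    using powr_subordination[of "\<alpha> / 2"] assms by auto
  have "mean_distance_power \<alpha> = (\<integral>x. 4 powr (\<alpha> / 2) / (\<alpha> / 2 + 1) \<partial>S2_prob)"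
    unfolding mean_distance_power_def powr_norm_eq
    using assms by (intro Bochner_Integration.integral_cong refl integral_S2_prob_powr[of _ c] c) auto
  then show ?thesis by (simp add: S.prob_space[unfolded space_S2_prob])
qed

section \<open>Gaussian energy as a squared norm\<close>

text \<open>This is the deficit \<open>E t\<close> of the introduction. The diagonal of the double
  sum contributes \<open>card P\<close>, unlike for powers of the distance.\<close>

definition gauss_energy :: "(real^3) set \<Rightarrow> real \<Rightarrow> real" where
  "gauss_energy P t = (\<Sum>x\<in>P. \<Sum>y\<in>P. exp (- t * (norm (x - y))\<^sup>2)) - (real (card P))\<^sup>2 * gauss_mean t"

text \<open>The exponent carries \<open>2 * t\<close> because the product of two such Gaussians
  integrates to a multiple of the kernel with parameter \<open>t\<close>.\<close>

definition gauss_discrepancy :: "(real^3) set \<Rightarrow> real \<Rightarrow> real^3 \<Rightarrow> real" where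
  "gauss_discrepancy P t z = (\<Sum>x\<in>P. exp (- (2 * t) * (norm (x - z))\<^sup>2)) -
     real (card P) * (\<integral>y. exp (- (2 * t) * (norm (y - z))\<^sup>2) \<partial>S2_prob)"

lemma has_bochner_integral_nonneg_real:
  fixes x :: real
  assumes "has_bochner_integral M f x" "\<And>z. 0 \<le> f z" shows "0 \<le> x"
  using Bochner_Integration.integral_nonneg[of M f] assms by (auto simp: has_bochner_integral_iff)

text \<open>Tonelli for a product with a spherical average. It is applied first with
  \<open>\<psi>\<close> a single Gaussian, then with \<open>\<psi>\<close> an averaged one.\<close>

lemma has_bochner_integral_mult_S2_average:
  fixes \<psi> :: "real^3 \<Rightarrow> real" and f :: "real^3 \<Rightarrow> real^3 \<Rightarrow> real"
  assumes [measurable]: "\<psi> \<in> borel_measurable borel" and \<psi>: "\<And>z. 0 \<le> \<psi> z"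
    and [measurable]: "(\<lambda>(y, z). f y z) \<in> borel_measurable (borel \<Otimes>\<^sub>M borel)"
    and f: "\<And>y z. 0 \<le> f y z" "\<And>z. continuous_on UNIV (\<lambda>y. f y z)"
    and J: "\<And>y. norm y = 1 \<Longrightarrow> has_bochner_integral lborel (\<lambda>z. \<psi> z * f y z) (J y)"
    and cont: "continuous_on UNIV J"
  shows "has_bochner_integral lborel (\<lambda>z. \<psi> z * (\<integral>y. f y z \<partial>S2_prob)) (\<integral>y. J y \<partial>S2_prob)"
proof -
  interpret S: prob_space S2_prob by (rule prob_space_S2_prob)
  interpret pair_sigma_finite S2_prob lborel ..
  have "(\<lambda>(z, y). f y z) \<in> borel_measurable (lborel \<Otimes>\<^sub>M S2_prob)" by measurable
  then have [measurable]: "(\<lambda>z. \<integral>y. f y z \<partial>S2_prob) \<in> borel_measurable borel"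
    using S.borel_measurable_lebesgue_integral[of "\<lambda>z y. f y z" lborel] by simp
  have Jnn: "0 \<le> J y" if "norm y = 1" for y
    by (rule has_bochner_integral_nonneg_real[OF J[OF that]]) (simp add: \<psi> f(1))
  have "(\<integral>\<^sup>+z. ennreal (\<psi> z * (\<integral>y. f y z \<partial>S2_prob)) \<partial>lborel) =
      (\<integral>\<^sup>+z. (\<integral>\<^sup>+y. ennreal (\<psi> z * f y z) \<partial>S2_prob) \<partial>lborel)"
    using \<psi> f by (intro nn_integral_cong, subst nn_integral_eq_integral)
      (auto intro!: integrable_mult_right integrable_S2_prob)
  also have "\<dots> = (\<integral>\<^sup>+y. (\<integral>\<^sup>+z. ennreal (\<psi> z * f y z) \<partial>lborel) \<partial>S2_prob)"
    by (rule Fubini') measurable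
  also have "\<dots> = (\<integral>\<^sup>+y. ennreal (J y) \<partial>S2_prob)"
  proof (rule nn_integral_cong)
    fix y assume "y \<in> space S2_prob"
    then have "norm y = 1" by simp
    from J[OF this] show "(\<integral>\<^sup>+z. ennreal (\<psi> z * f y z) \<partial>lborel) = ennreal (J y)"
      using \<psi> f(1) by (subst nn_integral_eq_integral) (auto simp: has_bochner_integral_iff)
  qed
  also have "\<dots> = ennreal (\<integral>y. J y \<partial>S2_prob)"
    using Jnn by (intro nn_integral_eq_integral integrable_S2_prob cont AE_I2) auto
  finally show ?thesis
    using \<psi> f(1) Jnn
    by (intro has_bochner_integral_nn_integral)
       (auto intro!: Bochner_Integration.integral_nonneg mult_nonneg_nonneg)
qed

text \<open>Expanding the square gives pair, cross and mean terms. Averaging one of two centres over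
  the sphere already removes the dependence on the other, so cross and mean terms both integrate to
  \<open>G * gauss_mean t\<close>, and their weights \<open>- 2 * n\<^sup>2\<close> and
  \<open>n\<^sup>2\<close> combine to \<open>- n\<^sup>2\<close>.\<close>

lemma has_bochner_integral_gauss_discrepancy:
  assumes P: "finite P" "P \<subseteq> sphere 0 1" and t: "t > 0"
  shows "has_bochner_integral lborel (\<lambda>z. (gauss_discrepancy P t z)\<^sup>2)
           (sqrt (pi / (4 * t)) ^ 3 * gauss_energy P t)"
proof -
  interpret S: prob_space S2_prob by (rule prob_space_S2_prob)
  define f where "f x z = exp (- (2 * t) * (norm (x - z))\<^sup>2)" for x z :: "real^3"
  define \<phi> where "\<phi> z = (\<integral>y. f y z \<partial>S2_prob)" for z
  define G where "G = sqrt (pi / (4 * t)) ^ 3"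
  define n where "n = real (card P)"
  have fm [measurable]: "(\<lambda>(y, z). f y z) \<in> borel_measurable (borel \<Otimes>\<^sub>M borel)"
    unfolding f_def by measurable
  have fnn: "0 \<le> f y z" for y z by (simp add: f_def)
  have fc: "continuous_on UNIV (\<lambda>y. f y z)" for z unfolding f_def by (intro continuous_intros)
  have ff: "has_bochner_integral lborel (\<lambda>z. f x z * f y z) (G * exp (- t * (norm (x - y))\<^sup>2))" for x y
    using has_bochner_integral_gaussian_mult[of "2 * t" x y] t by (simp add: f_def G_def mult.commute)
  have f\<phi>: "has_bochner_integral lborel (\<lambda>z. f x z * \<phi> z) (G * gauss_mean t)" if "norm x = 1" for x
  proof -
    have "has_bochner_integral lborel (\<lambda>z. f x z * \<phi> z) (\<integral>y. G * exp (- t * (norm (x - y))\<^sup>2) \<partial>S2_prob)"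
      unfolding \<phi>_def
      by (rule has_bochner_integral_mult_S2_average[OF _ fnn fm fnn fc ff]) (auto intro!: continuous_intros)
    then show ?thesis using integral_S2_prob_gaussian[OF t that] by (simp add: gauss_mean_def)
  qed
  have \<phi>nn: "0 \<le> \<phi> z" for z unfolding \<phi>_def by (intro Bochner_Integration.integral_nonneg fnn)
  have [measurable]: "\<phi> \<in> borel_measurable borel"
    unfolding \<phi>_def using S.borel_measurable_lebesgue_integral[of "\<lambda>z y. f y z" borel] by simp
  have \<phi>\<phi>: "has_bochner_integral lborel (\<lambda>z. \<phi> z * \<phi> z) (G * gauss_mean t)"
  proof -
    have "has_bochner_integral lborel (\<lambda>z. \<phi> z * \<phi> z) (\<integral>y. G * gauss_mean t \<partial>S2_prob)"
      unfolding \<phi>_def[of z for z, symmetric]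
      using has_bochner_integral_mult_S2_average[OF _ \<phi>nn fm fnn fc, where J = "\<lambda>_. G * gauss_mean t"] f\<phi>
      by (simp add: \<phi>_def[symmetric] mult.commute)
    then show ?thesis by (simp add: S.prob_space[unfolded space_S2_prob])
  qed
  have "has_bochner_integral lborel
     (\<lambda>z. (\<Sum>x\<in>P. \<Sum>y\<in>P. f x z * f y z) - 2 * n * (\<Sum>x\<in>P. f x z * \<phi> z) + n\<^sup>2 * (\<phi> z * \<phi> z))
     ((\<Sum>x\<in>P. \<Sum>y\<in>P. G * exp (- t * (norm (x - y))\<^sup>2)) - 2 * n * (\<Sum>x\<in>P. G * gauss_mean t) + n\<^sup>2 * (G * gauss_mean t))"
    using P(2) by (intro has_bochner_integral_add has_bochner_integral_diff has_bochner_integral_sum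
        has_bochner_integral_mult_right ff f\<phi> \<phi>\<phi>) auto
  also have "(\<lambda>z. (\<Sum>x\<in>P. \<Sum>y\<in>P. f x z * f y z) - 2 * n * (\<Sum>x\<in>P. f x z * \<phi> z) + n\<^sup>2 * (\<phi> z * \<phi> z)) =
      (\<lambda>z. (gauss_discrepancy P t z)\<^sup>2)"
  proof
    fix z
    define S where "S = (\<Sum>x\<in>P. f x z)"
    have "gauss_discrepancy P t z = S - n * \<phi> z"
      by (simp add: gauss_discrepancy_def f_def \<phi>_def n_def S_def)
    moreover have "(\<Sum>x\<in>P. \<Sum>y\<in>P. f x z * f y z) = S * S" "(\<Sum>x\<in>P. f x z * \<phi> z) = S * \<phi> z"
      unfolding S_def by (rule sum_product[symmetric], rule sum_distrib_right[symmetric])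
    ultimately show "(\<Sum>x\<in>P. \<Sum>y\<in>P. f x z * f y z) - 2 * n * (\<Sum>x\<in>P. f x z * \<phi> z) + n\<^sup>2 * (\<phi> z * \<phi> z) =
      (gauss_discrepancy P t z)\<^sup>2"
      by (simp only:) (simp add: power2_eq_square algebra_simps)
  qed
  also have "(\<Sum>x\<in>P. \<Sum>y\<in>P. G * exp (- t * (norm (x - y))\<^sup>2)) - 2 * n * (\<Sum>x\<in>P. G * gauss_mean t) + n\<^sup>2 * (G * gauss_mean t)
     = G * gauss_energy P t"
    by (simp add: gauss_energy_def n_def[symmetric] sum_distrib_left[symmetric] algebra_simps power2_eq_square)
  finally show ?thesis unfolding G_def .
qed

lemma gauss_energy_nonneg:
  assumes "finite P" "P \<subseteq> sphere 0 1" "t > 0" shows "0 \<le> gauss_energy P t"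
proof -
  have "0 \<le> sqrt (pi / (4 * t)) ^ 3 * gauss_energy P t"
    by (rule has_bochner_integral_nonneg_real[OF has_bochner_integral_gauss_discrepancy[OF assms]]) simp
  moreover have "0 < sqrt (pi / (4 * t)) ^ 3" using assms(3) by simp
  ultimately show ?thesis by (simp add: zero_le_mult_iff)
qed

section \<open>From Gaussian energy to the energy of powers\<close>

text \<open>The nonnegative mean term is dropped, the kernel is compared with its value at parameter
  \<open>n\<close>, and adding the mean term back there costs at most
  \<open>n\<^sup>2 / (4 * n)\<close>.\<close>

lemma gauss_energy_le_card:
  fixes t C :: real
  assumes P: "finite P" "P \<subseteq> sphere 0 1" "P \<noteq> {}" and C: "gauss_energy P (card P) \<le> C * card P" and t: "t \<ge> card P"
  shows "gauss_energy P t \<le> (C + 1) * card P"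
proof -
  define n where "n = real (card P)"
  have n: "n > 0" using P by (simp add: n_def card_gt_0_iff)
  have "gauss_energy P t \<le> (\<Sum>x\<in>P. \<Sum>y\<in>P. exp (- t * (norm (x - y))\<^sup>2))"
    using gauss_mean_nonneg[of t] t n by (simp add: gauss_energy_def n_def)
  also have "\<dots> \<le> (\<Sum>x\<in>P. \<Sum>y\<in>P. exp (- n * (norm (x - y))\<^sup>2))"
    using t by (intro sum_mono) (auto intro!: mult_right_mono simp: n_def)
  also have "\<dots> = gauss_energy P n + n\<^sup>2 * gauss_mean n"
    by (simp add: gauss_energy_def n_def)
  also have "n\<^sup>2 * gauss_mean n \<le> n\<^sup>2 * (1 / (4 * n))"
    using gauss_mean_le[OF n] by (intro mult_left_mono) auto
  also have "n\<^sup>2 * (1 / (4 * n)) \<le> n" using n by (simp add: power2_eq_square)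
  finally show ?thesis using C by (simp add: n_def algebra_simps)
qed

lemma energy_deficit_bounds:
  fixes b C :: real assumes b: "0 < b" "b < 1" and C: "0 \<le> C"
  obtains D where "D > 0"
    "\<And>P. \<lbrakk>finite P; P \<subseteq> sphere 0 1; P \<noteq> {}; \<And>t::real. 0 < t \<Longrightarrow> t \<le> card P \<Longrightarrow> gauss_energy P t \<le> C * t\<rbrakk> \<Longrightarrow>
      0 \<le> 4 powr b / (b + 1) * (real (card P))\<^sup>2 - (\<Sum>x\<in>P. \<Sum>y\<in>P. ((norm (x - y))\<^sup>2) powr b) \<and>
      4 powr b / (b + 1) * (real (card P))\<^sup>2 - (\<Sum>x\<in>P. \<Sum>y\<in>P. ((norm (x - y))\<^sup>2) powr b)
        \<le> D * real (card P) powr (1 - b)"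
proof -
  obtain c where c: "c > 0" and sub: "\<And>a. a \<ge> 0 \<Longrightarrow>
    has_bochner_integral lborel (\<lambda>t. indicator {0<..} t * ((1 - exp (- t * a)) * t powr (- 1 - b))) (c * a powr b)"
    by (rule powr_subordination[OF b]) blast
  \<comment> \<open>The two summands come from integrating \<open>C * t powr (- b)\<close> up to
    \<open>n\<close> and \<open>(C + 1) * n * t powr (- 1 - b)\<close> beyond \<open>n\<close>;
    \<open>c\<close> is the constant of the subordination.\<close>
  define D where "D = (C / (1 - b) + (C + 1) / b) / c"
  have "D > 0" using b C c by (auto simp: D_def intro!: divide_pos_pos add_nonneg_pos)
  moreover have "0 \<le> 4 powr b / (b + 1) * (real (card P))\<^sup>2 - (\<Sum>x\<in>P. \<Sum>y\<in>P. ((norm (x - y))\<^sup>2) powr b) \<and>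
      4 powr b / (b + 1) * (real (card P))\<^sup>2 - (\<Sum>x\<in>P. \<Sum>y\<in>P. ((norm (x - y))\<^sup>2) powr b)
        \<le> D * real (card P) powr (1 - b)"
    if P: "finite P" "P \<subseteq> sphere 0 1" "P \<noteq> {}" and E: "\<And>t::real. 0 < t \<Longrightarrow> t \<le> card P \<Longrightarrow> gauss_energy P t \<le> C * t" for P
  proof -
    define n where "n = real (card P)"
    define W where "W t = indicator {0<..} t * (gauss_energy P t * t powr (- 1 - b))" for t :: real
    define \<Delta> where "\<Delta> = 4 powr b / (b + 1) * n\<^sup>2 - (\<Sum>x\<in>P. \<Sum>y\<in>P. ((norm (x - y))\<^sup>2) powr b)"
    have n: "n > 0" using P by (simp add: n_def card_gt_0_iff)
    obtain p where "p \<in> P" using P by blast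
    then have p: "norm p = 1" using P by auto
    \<comment> \<open>The formula for the mean, taken \<open>n\<^sup>2\<close> times, minus the
      formulas for all pairs: the constants 1 cancel and the Gaussian energy remains.\<close>
    have "has_bochner_integral lborel (\<lambda>t. n\<^sup>2 * (indicator {0<..} t * ((1 - gauss_mean t) * t powr (- 1 - b))) -
       (\<Sum>x\<in>P. \<Sum>y\<in>P. indicator {0<..} t * ((1 - exp (- t * (norm (x - y))\<^sup>2)) * t powr (- 1 - b))))
       (n\<^sup>2 * (c * (4 powr b / (b + 1))) - (\<Sum>x\<in>P. \<Sum>y\<in>P. c * ((norm (x - y))\<^sup>2) powr b))"
      by (intro has_bochner_integral_diff has_bochner_integral_mult_right has_bochner_integral_sum sub
          has_bochner_integral_gauss_mean[OF b(1) c p sub]) auto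
    also have "(\<lambda>t. n\<^sup>2 * (indicator {0<..} t * ((1 - gauss_mean t) * t powr (- 1 - b))) -
       (\<Sum>x\<in>P. \<Sum>y\<in>P. indicator {0<..} t * ((1 - exp (- t * (norm (x - y))\<^sup>2)) * t powr (- 1 - b)))) = W"
      by (rule ext) (simp add: W_def gauss_energy_def n_def sum_distrib_left[symmetric] sum_distrib_right[symmetric]
          sum_subtractf power2_eq_square algebra_simps)
    also have "n\<^sup>2 * (c * (4 powr b / (b + 1))) - (\<Sum>x\<in>P. \<Sum>y\<in>P. c * ((norm (x - y))\<^sup>2) powr b) = c * \<Delta>"
      by (simp add: \<Delta>_def sum_distrib_left right_diff_distrib)
    finally have W: "has_bochner_integral lborel W (c * \<Delta>)" .
    have Wnn: "0 \<le> W t" for t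
      using gauss_energy_nonneg[OF P(1,2), of t] by (auto simp: W_def indicator_def)
    have "0 \<le> c * \<Delta>"
      by (rule has_bochner_integral_nonneg_real[OF W Wnn])
    then have "0 \<le> \<Delta>" using c by (simp add: zero_le_mult_iff)
    moreover have "\<Delta> \<le> D * n powr (1 - b)"
    proof -
      have "W t \<le> C * (indicator {0..n} t * t powr (- b)) + (C + 1) * n * (indicator {n..} t * t powr (- 1 - b))" for t
      proof (cases "t > 0")
        case True
        show ?thesis
        proof (cases "t \<le> n")
          case le: True
          have "W t \<le> (C * t) * t powr (- 1 - b)"
            using E[OF True] le True by (auto simp: W_def n_def intro!: mult_right_mono)
          also have "\<dots> = C * t powr (- b)"
            using powr_mult_base[of t "- 1 - b"] True by (simp add: mult.assoc)
          also have "\<dots> \<le> C * (indicator {0..n} t * t powr (- b)) + (C + 1) * n * (indicator {n..} t * t powr (- 1 - b))"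
            using C n le True by (simp add: indicator_def)
          finally show ?thesis .
        next
          case False
          then have "W t \<le> ((C + 1) * n) * t powr (- 1 - b)"
            using gauss_energy_le_card[OF P E[OF n[unfolded n_def] order_refl], of t] True by (auto simp: W_def n_def intro!: mult_right_mono)
          then show ?thesis using False by simp
        qed
      qed (use C n in \<open>simp add: W_def\<close>)
      then have "ennreal (c * \<Delta>) \<le> (\<integral>\<^sup>+t. ennreal (C * (indicator {0..n} t * t powr (- b)) +
          (C + 1) * n * (indicator {n..} t * t powr (- 1 - b))) \<partial>lborel)"
        using W Wnn by (subst has_bochner_integral_integral_eq[OF W, symmetric],
          subst nn_integral_eq_integral[symmetric]) (auto simp: has_bochner_integral_iff intro!: nn_integral_mono ennreal_leI)
      also have "\<dots> = (\<integral>\<^sup>+t. ennreal C * ennreal (indicator {0..n} t * t powr (- b)) +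
          ennreal ((C + 1) * n) * ennreal (indicator {n..} t * t powr (- 1 - b)) \<partial>lborel)"
        using C n by (simp add: ennreal_mult ennreal_plus)
      also have "\<dots> = ennreal C * ennreal (n powr (1 - b) / (1 - b)) + ennreal ((C + 1) * n) * ennreal (n powr (- b) / b)"
        using b n by (subst nn_integral_add)
          (auto simp: nn_integral_cmult nn_integral_powr_from_0 nn_integral_powr_to_inf)
      also have "\<dots> = ennreal (C * (n powr (1 - b) / (1 - b)) + (C + 1) * n * (n powr (- b) / b))"
      proof (subst ennreal_plus)
        show "0 \<le> C * (n powr (1 - b) / (1 - b))" "0 \<le> (C + 1) * n * (n powr (- b) / b)"
          using C n b by (auto intro!: mult_nonneg_nonneg divide_nonneg_nonneg)
      qed (use C n in \<open>simp_all only: ennreal_mult' [symmetric] mult_nonneg_nonneg add_nonneg_nonneg zero_le_one less_imp_le\<close>)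
      also have "C * (n powr (1 - b) / (1 - b)) + (C + 1) * n * (n powr (- b) / b) = c * (D * n powr (1 - b))"
        using powr_mult_base[of n "- b"] n c by (simp add: D_def distrib_right flip: mult.assoc)
      finally have "c * \<Delta> \<le> c * (D * n powr (1 - b))"
        using \<open>D > 0\<close> c by (subst (asm) ennreal_le_iff) auto
      then show ?thesis using c by simp
    qed
    ultimately show ?thesis by (simp add: \<Delta>_def n_def)
  qed
  ultimately show ?thesis by (rule that)
qed

section \<open>Energy of points with centred cells\<close>

text \<open>\<open>\<Lambda>\<close> is the averaging functional of a probability measure supported in \<open>K\<close>, and \<open>m\<close> bounds
  the distance of its centroid from the reference point \<open>x\<close>.\<close>

locale sphere_cell =
  fixes \<Lambda> :: "(real^3 \<Rightarrow> real) \<Rightarrow> real" and K :: "(real^3) set" and x :: "real^3" and d m :: real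
  assumes add: "continuous_on UNIV g \<Longrightarrow> continuous_on UNIV h \<Longrightarrow> \<Lambda> (\<lambda>y. g y + h y) = \<Lambda> g + \<Lambda> h"
    and scale: "continuous_on UNIV g \<Longrightarrow> \<Lambda> (\<lambda>y. c * g y) = c * \<Lambda> g"
    and upper: "continuous_on UNIV g \<Longrightarrow> (\<And>y. y \<in> K \<Longrightarrow> g y \<le> B) \<Longrightarrow> \<Lambda> g \<le> B"
    and dist: "y \<in> K \<Longrightarrow> (norm (y - x))\<^sup>2 \<le> d"
    and moment: "\<bar>\<Lambda> (\<lambda>y. p \<bullet> (y - x))\<bar> \<le> norm p * m"
begin

lemma lower:
  assumes "continuous_on UNIV g" "\<And>y. y \<in> K \<Longrightarrow> B \<le> g y" shows "B \<le> \<Lambda> g"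
  using upper[of "\<lambda>y. (- 1) * g y" "- B"] scale[OF assms(1), of "- 1"] assms
  by (auto intro!: continuous_intros)

lemma const: "\<Lambda> (\<lambda>y. c) = c"
  using upper[of "\<lambda>y. c" c] lower[of "\<lambda>y. c" c] by (auto intro!: antisym)

text \<open>The Gaussian minus its linear part at \<open>x\<close> is quadratically small on the
  cell, while the linear part averages to at most the centroid offset \<open>m\<close>. Half of the
  decay \<open>exp (- 2 * q\<^sup>2)\<close> pays for the growing factors, which leaves
  \<open>exp (- q\<^sup>2)\<close>.\<close>

lemma gaussian_second_order:
  fixes t n \<rho> A :: real and z :: "real^3"
  assumes t: "0 < t" "t \<le> n" and A: "A \<ge> 1" and d: "d = A / n" and m: "m = A / (n * \<rho>)" and \<rho>: "\<rho> > 0"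
  shows "\<bar>exp (- (2 * t) * (norm (x - z))\<^sup>2) - \<Lambda> (\<lambda>y. exp (- (2 * t) * (norm (y - z))\<^sup>2))\<bar>
    \<le> (32 * A\<^sup>2 * exp (10 * A) + 4 * A) * (t / n + sqrt t / (n * \<rho>)) * exp (- t * (norm (x - z))\<^sup>2)"
proof -
  define p where "p = x - z"
  define q where "q = sqrt t * norm p"
  define \<tau> where "\<tau> = t / n"
  define E where "E = exp (- 2 * q\<^sup>2)"
  define f where "f y = exp (- (2 * t) * (norm (y - z))\<^sup>2)" for y
  define M where "M = 16 * A\<^sup>2 * \<tau> * (1 + q\<^sup>2) * exp (4 * sqrt A * q + 2 * A)"
  \<comment> \<open>\<open>f\<close> minus its first-order Taylor polynomial at \<open>x\<close>,
    where the gradient of \<open>f\<close> is \<open>- 4 * t * E\<close> times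
    \<open>p\<close>.\<close>
  define h where "h y = f y + (- E + 4 * t * E * (p \<bullet> (y - x)))" for y
  have n: "n > 0" using t by linarith
  have \<tau>: "0 < \<tau>" "\<tau> \<le> 1" using t n by (auto simp: \<tau>_def)
  have q0: "q \<ge> 0" using t by (simp add: q_def)
  have q2: "q\<^sup>2 = t * (norm p)\<^sup>2" using t by (simp add: q_def power_mult_distrib)
  have fE: "f x = E" by (simp add: f_def E_def q2 p_def mult.assoc)
  have fc: "continuous_on UNIV f" unfolding f_def by (intro continuous_intros)
  have hc: "continuous_on UNIV h" unfolding h_def by (intro continuous_intros fc)
  have h_le: "\<bar>h y\<bar> \<le> E * (M + 2 * A * \<tau>)" if y: "y \<in> K" for y
  proof -
    define v where "v = y - x"
    \<comment> \<open>The change of the exponent between \<open>x\<close> and \<open>y\<close>, so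
      that \<open>f y = E * exp u\<close>. Its quadratic part is not in the Taylor polynomial and
      reappears as the term \<open>2 * (t * (norm v)\<^sup>2)\<close> of \<open>h y\<close>.\<close>
    define u where "u = - (4 * t) * (p \<bullet> v) - 2 * t * (norm v)\<^sup>2"
    have v2: "t * (norm v)\<^sup>2 \<le> A * \<tau>"
      using mult_left_mono[OF dist[OF y], of t] t by (simp add: v_def d \<tau>_def mult.commute)
    then have "sqrt t * norm v \<le> sqrt (A * \<tau>)"
      using real_sqrt_le_mono[OF v2] t by (simp add: real_sqrt_mult)
    have "\<bar>t * (p \<bullet> v)\<bar> \<le> t * (norm p * norm v)"
      using Cauchy_Schwarz_ineq2[of p v] t by (simp add: abs_mult)
    also have "\<dots> = q * (sqrt t * norm v)"
      using t by (simp add: q_def)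
    also have "\<dots> \<le> q * sqrt (A * \<tau>)"
      by (intro mult_left_mono q0) fact
    finally have pv: "\<bar>t * (p \<bullet> v)\<bar> \<le> q * sqrt (A * \<tau>)" .
    have u_le: "\<bar>u\<bar> \<le> 4 * (q * sqrt (A * \<tau>)) + 2 * (A * \<tau>)"
    proof -
      have "u = - 4 * (t * (p \<bullet> v)) - 2 * (t * (norm v)\<^sup>2)" by (simp add: u_def)
      moreover have "0 \<le> t * (norm v)\<^sup>2" using t by simp
      ultimately show ?thesis using pv v2 by linarith
    qed
    have "u\<^sup>2 \<le> (4 * (q * sqrt (A * \<tau>)) + 2 * (A * \<tau>))\<^sup>2"
      using u_le by (metis abs_ge_zero power2_abs power_mono)
    also have "\<dots> \<le> 2 * (4 * (q * sqrt (A * \<tau>)))\<^sup>2 + 2 * (2 * (A * \<tau>))\<^sup>2"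
      using sum_squares_bound[of "4 * (q * sqrt (A * \<tau>))" "2 * (A * \<tau>)"] by (simp add: power2_sum)
    also have "\<dots> = 32 * q\<^sup>2 * (A * \<tau>) + 8 * A\<^sup>2 * (\<tau> * \<tau>)"
      using A \<tau> by (simp add: power_mult_distrib power2_eq_square)
    also have "\<dots> \<le> 32 * q\<^sup>2 * (A\<^sup>2 * \<tau>) + 8 * A\<^sup>2 * (\<tau> * 1)"
      using A \<tau> by (intro add_mono mult_left_mono mult_right_mono) (auto simp: power2_eq_square)
    also have "\<dots> \<le> 32 * A\<^sup>2 * \<tau> * (1 + q\<^sup>2)"
      using \<tau> by (simp add: algebra_simps)
    finally have u2: "u\<^sup>2 \<le> 32 * A\<^sup>2 * \<tau> * (1 + q\<^sup>2)" .
    have "A * \<tau> \<le> A" using A \<tau> by simp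
    then have "4 * (q * sqrt (A * \<tau>)) + 2 * (A * \<tau>) \<le> 4 * sqrt A * q + 2 * A"
      using q0 mult_left_mono[of "sqrt (A * \<tau>)" "sqrt A" q] by (simp add: mult.commute[of _ q] mult.left_commute[of _ q])
    with u_le have u1: "\<bar>u\<bar> \<le> 4 * sqrt A * q + 2 * A" by linarith
    have "\<bar>exp u - 1 - u\<bar> \<le> exp \<bar>u\<bar> * u\<^sup>2 / 2"
    proof -
      obtain w where w: "\<bar>w\<bar> \<le> \<bar>u\<bar>" "exp u = (\<Sum>k<2. u ^ k / fact k) + exp w / fact 2 * u ^ 2"
        using Maclaurin_exp_le[of u 2] by blast
      then have "exp u - 1 - u = exp w * u\<^sup>2 / 2" by (simp add: numeral_2_eq_2)
      then have "\<bar>exp u - 1 - u\<bar> = exp w * u\<^sup>2 / 2" by (simp only:) simp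
      also have "\<dots> \<le> exp \<bar>u\<bar> * u\<^sup>2 / 2"
        using w(1) by (intro divide_right_mono mult_right_mono) auto
      finally show ?thesis .
    qed
    also have "\<dots> \<le> exp (4 * sqrt A * q + 2 * A) * (32 * A\<^sup>2 * \<tau> * (1 + q\<^sup>2)) / 2"
      using u1 u2 by (intro divide_right_mono mult_mono) auto
    also have "\<dots> = M" by (simp add: M_def)
    finally have M: "\<bar>exp u - 1 - u\<bar> \<le> M" .
    have "(norm (y - z))\<^sup>2 = (norm p)\<^sup>2 + 2 * (p \<bullet> v) + (norm v)\<^sup>2"
      by (simp add: p_def v_def power2_norm_eq_inner inner_diff_left inner_diff_right inner_commute)
    then have "- (2 * t) * (norm (y - z))\<^sup>2 = - 2 * q\<^sup>2 + u"
      by (simp add: q2 u_def algebra_simps)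
    then have "f y = E * exp u" by (simp only: f_def E_def exp_add)
    then have "h y = E * ((exp u - 1 - u) - 2 * (t * (norm v)\<^sup>2))"
      by (simp add: h_def u_def v_def algebra_simps)
    moreover have "\<bar>(exp u - 1 - u) - 2 * (t * (norm v)\<^sup>2)\<bar> \<le> M + 2 * A * \<tau>"
    proof -
      have "0 \<le> t * (norm v)\<^sup>2" using t by simp
      with M v2 show ?thesis by linarith
    qed
    ultimately show ?thesis by (simp add: abs_mult E_def)
  qed
  have lin: "\<Lambda> h = \<Lambda> f + (- E + 4 * t * E * \<Lambda> (\<lambda>y. p \<bullet> (y - x)))"
    unfolding h_def
    by (subst add, simp add: fc, intro continuous_intros, subst add, intro continuous_intros, intro continuous_intros,
        subst scale, intro continuous_intros) (simp add: const)
  have "\<Lambda> h \<le> E * (M + 2 * A * \<tau>)"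
    by (rule upper[OF hc]) (rule abs_le_D1[OF h_le])
  moreover have "- (E * (M + 2 * A * \<tau>)) \<le> \<Lambda> h"
    using h_le by (intro lower[OF hc]) (force simp: abs_le_iff)
  moreover have "\<bar>4 * t * E * \<Lambda> (\<lambda>y. p \<bullet> (y - x))\<bar> \<le> 4 * t * E * (norm p * m)"
    using moment[of p] t by (simp add: abs_mult E_def)
  ultimately have "\<bar>E - \<Lambda> f\<bar> \<le> E * (M + 2 * A * \<tau>) + 4 * t * E * (norm p * m)"
    unfolding lin by linarith
  also have "4 * t * E * (norm p * m) = (4 * A * (sqrt t / (n * \<rho>))) * (q * E)"
    using t by (simp add: q_def m)
  finally have main: "\<bar>E - \<Lambda> f\<bar> \<le> E * M + E * (2 * A * \<tau>) + (4 * A * (sqrt t / (n * \<rho>))) * (q * E)"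
    by (simp add: distrib_left)
  have EM: "E * M \<le> 32 * A\<^sup>2 * exp (10 * A) * \<tau> * exp (- q\<^sup>2)"
  proof -
    \<comment> \<open>The arithmetic-geometric mean inequality splits off
      \<open>q\<^sup>2 / 2\<close>, the factor \<open>1 + q\<^sup>2\<close> costs another
      \<open>q\<^sup>2 / 2\<close>, and the constants add up to \<open>10 * A\<close>.\<close>
    have "4 * sqrt A * q \<le> q\<^sup>2 / 2 + 8 * A"
      using sum_squares_bound[of q "4 * sqrt A"] A by (simp add: power_mult_distrib algebra_simps)
    moreover have "1 + q\<^sup>2 \<le> 2 * exp (q\<^sup>2 / 2)"
      using exp_ge_add_one_self[of "q\<^sup>2 / 2"] by linarith
    ultimately have "(1 + q\<^sup>2) * exp (4 * sqrt A * q + 2 * A) \<le> 2 * exp (q\<^sup>2 / 2) * exp (q\<^sup>2 / 2 + 8 * A + 2 * A)"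
      by (intro mult_mono) auto
    also have "\<dots> = 2 * exp (10 * A) * exp (q\<^sup>2)" by (simp flip: exp_add)
    finally have "E * (16 * A\<^sup>2 * \<tau>) * ((1 + q\<^sup>2) * exp (4 * sqrt A * q + 2 * A))
       \<le> E * (16 * A\<^sup>2 * \<tau>) * (2 * exp (10 * A) * exp (q\<^sup>2))"
      using \<tau> by (intro mult_left_mono) (auto simp: E_def)
    also have "\<dots> = 32 * A\<^sup>2 * exp (10 * A) * \<tau> * (E * exp (q\<^sup>2))" by simp
    also have "E * exp (q\<^sup>2) = exp (- q\<^sup>2)" by (simp add: E_def flip: exp_add)
    finally show ?thesis by (simp add: M_def mult.assoc)
  qed
  have E_le: "E \<le> exp (- q\<^sup>2)" by (simp add: E_def)
  have "q \<le> 1 + q\<^sup>2" using sum_squares_bound[of q 1] q0 by simp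
  also have "\<dots> \<le> exp (q\<^sup>2)" using exp_ge_add_one_self[of "q\<^sup>2"] by simp
  finally have "q * E \<le> exp (q\<^sup>2) * E" by (intro mult_right_mono) (auto simp: E_def)
  also have "\<dots> = exp (- q\<^sup>2)" by (simp add: E_def flip: exp_add)
  finally have qE: "q * E \<le> exp (- q\<^sup>2)" .
  have "\<bar>E - \<Lambda> f\<bar> \<le> 32 * A\<^sup>2 * exp (10 * A) * \<tau> * exp (- q\<^sup>2) + exp (- q\<^sup>2) * (4 * A * \<tau>)
      + (4 * A * (sqrt t / (n * \<rho>))) * exp (- q\<^sup>2)"
  proof -
    have "E * (2 * A * \<tau>) \<le> exp (- q\<^sup>2) * (4 * A * \<tau>)"
      using E_le A \<tau> by (intro mult_mono) auto
    moreover have "(4 * A * (sqrt t / (n * \<rho>))) * (q * E) \<le> (4 * A * (sqrt t / (n * \<rho>))) * exp (- q\<^sup>2)"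
      using qE A t n \<rho> by (intro mult_left_mono) auto
    ultimately show ?thesis using main EM by linarith
  qed
  also have "\<dots> \<le> (32 * A\<^sup>2 * exp (10 * A) + 4 * A) * (\<tau> + sqrt t / (n * \<rho>)) * exp (- q\<^sup>2)"
    using A t n \<rho> by (simp add: algebra_simps)
  finally show ?thesis by (simp add: fE[symmetric] f_def[abs_def] \<tau>_def q2 p_def)
qed

end

lemma has_bochner_integral_le:
  fixes f g :: "'a \<Rightarrow> real"
  assumes "has_bochner_integral M f a" "has_bochner_integral M g b" "\<And>z. f z \<le> g z" shows "a \<le> b"
  using integral_mono[of M f g] assms by (auto simp: has_bochner_integral_iff)

text \<open>The cell estimates bound the discrepancy by \<open>C * (Sa + Sb)\<close>. The norm of
  \<open>Sa\<close> is controlled by comparing sums over points with spherical means, which decay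
  like \<open>1 / t\<close>; for \<open>Sb\<close> it is enough to bound the Gaussians by 1 and to
  use the bound on the sum of \<open>1 / \<rho> i\<close>.\<close>

lemma gauss_energy_le_of_cells:
  fixes x :: "'i \<Rightarrow> real^3" and \<rho> :: "'i \<Rightarrow> real" and A L t :: real
  assumes I: "finite I" "I \<noteq> {}" "inj_on x I" "x ` I \<subseteq> sphere 0 1"
    and cell: "\<And>i. i \<in> I \<Longrightarrow> sphere_cell (\<Lambda> i) (K i) (x i) (A / card I) (A / (card I * \<rho> i))"
    and part: "\<And>g. continuous_on UNIV g \<Longrightarrow> (\<Sum>i\<in>I. \<Lambda> i g) = card I * (\<integral>y. g y \<partial>S2_prob)"
    and A: "A \<ge> 1" and \<rho>: "\<And>i. i \<in> I \<Longrightarrow> \<rho> i > 0" and sum: "(\<Sum>i\<in>I. 1 / \<rho> i) \<le> L * card I"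
    and t: "0 < t" "t \<le> card I"
  shows "gauss_energy (x ` I) t \<le> 6 * (32 * A\<^sup>2 * exp (10 * A) + 4 * A)\<^sup>2 * (exp (A / 2) + L\<^sup>2) * t"
proof -
  define n where "n = real (card I)"
  define C where "C = 32 * A\<^sup>2 * exp (10 * A) + 4 * A"
  define e where "e i z = exp (- t * (norm (x i - z))\<^sup>2)" for i z
  define Sa where "Sa z = (t / n) * (\<Sum>i\<in>I. e i z)" for z
  define Sb where "Sb z = (sqrt t / n) * (\<Sum>i\<in>I. (1 / \<rho> i) * e i z)" for z
  \<comment> \<open>\<open>G\<close> and \<open>G'\<close> are the Gaussian normalisations for
    products with exponents \<open>2 * t\<close> and \<open>t\<close> respectively.\<close>
  define G where "G = sqrt (pi / (4 * t)) ^ 3"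
  define G' where "G' = sqrt (pi / (2 * t)) ^ 3"
  have n: "n > 0" using I by (simp add: n_def card_gt_0_iff)
  have tn: "t \<le> n" using t by (simp add: n_def)
  have card: "card (x ` I) = card I" by (rule card_image[OF I(3)])
  have C0: "C \<ge> 0" using A by (simp add: C_def)
  have unit: "norm (x i) = 1" if "i \<in> I" for i using I(4) that by auto
  have disc: "\<bar>gauss_discrepancy (x ` I) t z\<bar> \<le> C * (Sa z + Sb z)" for z
  proof -
    define f where "f y = exp (- (2 * t) * (norm (y - z))\<^sup>2)" for y
    have "continuous_on UNIV f" unfolding f_def by (intro continuous_intros)
    from part[OF this] have "gauss_discrepancy (x ` I) t z = (\<Sum>i\<in>I. f (x i) - \<Lambda> i f)"
      by (simp add: gauss_discrepancy_def card sum.reindex[OF I(3)] sum_subtractf f_def)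
    also have "\<bar>\<dots>\<bar> \<le> (\<Sum>i\<in>I. \<bar>f (x i) - \<Lambda> i f\<bar>)" by (rule sum_abs)
    also have "\<dots> \<le> (\<Sum>i\<in>I. C * (t / n + sqrt t / (n * \<rho> i)) * e i z)"
      unfolding f_def C_def e_def n_def
      by (intro sum_mono sphere_cell.gaussian_second_order[OF cell]) (use t A \<rho> in auto)
    also have "\<dots> = C * (Sa z + Sb z)"
      by (simp add: Sa_def Sb_def sum_distrib_left sum.distrib[symmetric] algebra_simps)
    finally show ?thesis .
  qed
  have ee: "has_bochner_integral lborel (\<lambda>z. e i z * e j z) (exp (- (t / 2) * (norm (x i - x j))\<^sup>2) * G')" for i j
    using has_bochner_integral_gaussian_mult[of t "x i" "x j"] t by (simp add: e_def G'_def)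
  have Sa: "has_bochner_integral lborel (\<lambda>z. (Sa z)\<^sup>2)
      (\<Sum>i\<in>I. \<Sum>j\<in>I. (t / n)\<^sup>2 * (exp (- (t / 2) * (norm (x i - x j))\<^sup>2) * G'))" (is "has_bochner_integral _ _ ?Ra")
  proof -
    have "(Sa z)\<^sup>2 = (\<Sum>i\<in>I. \<Sum>j\<in>I. (t / n)\<^sup>2 * (e i z * e j z))" for z
    proof -
      have "(Sa z)\<^sup>2 = (t / n)\<^sup>2 * ((\<Sum>i\<in>I. e i z) * (\<Sum>j\<in>I. e j z))"
        by (simp add: Sa_def power_mult_distrib power2_eq_square)
      also have "\<dots> = (\<Sum>i\<in>I. \<Sum>j\<in>I. (t / n)\<^sup>2 * (e i z * e j z))"
        unfolding sum_product by (simp only: sum_distrib_left)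
      finally show ?thesis .
    qed
    then show ?thesis
      by (simp only:) (intro has_bochner_integral_sum has_bochner_integral_mult_right ee)
  qed
  have Sb: "has_bochner_integral lborel (\<lambda>z. (Sb z)\<^sup>2)
      (\<Sum>i\<in>I. \<Sum>j\<in>I. (t / n\<^sup>2 * (1 / \<rho> i * (1 / \<rho> j))) * (exp (- (t / 2) * (norm (x i - x j))\<^sup>2) * G'))"
    (is "has_bochner_integral _ _ ?Rb")
  proof -
    have "(Sb z)\<^sup>2 = (\<Sum>i\<in>I. \<Sum>j\<in>I. (t / n\<^sup>2 * (1 / \<rho> i * (1 / \<rho> j))) * (e i z * e j z))" for z
    proof -
      have "(Sb z)\<^sup>2 = t / n\<^sup>2 * ((\<Sum>i\<in>I. (1 / \<rho> i) * e i z) * (\<Sum>j\<in>I. (1 / \<rho> j) * e j z))"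
        using t by (simp add: Sb_def power_mult_distrib power_divide power2_eq_square)
      also have "\<dots> = (\<Sum>i\<in>I. \<Sum>j\<in>I. (t / n\<^sup>2 * (1 / \<rho> i * (1 / \<rho> j))) * (e i z * e j z))"
        unfolding sum_product by (simp only: sum_distrib_left) (intro sum.cong refl, simp)
      finally show ?thesis .
    qed
    then show ?thesis
      by (simp only:) (intro has_bochner_integral_sum has_bochner_integral_mult_right ee)
  qed
  have "G * gauss_energy (x ` I) t \<le> 2 * C\<^sup>2 * (?Ra + ?Rb)"
  proof (rule has_bochner_integral_le)
    show "has_bochner_integral lborel (\<lambda>z. (gauss_discrepancy (x ` I) t z)\<^sup>2) (G * gauss_energy (x ` I) t)"
      unfolding G_def using I t by (intro has_bochner_integral_gauss_discrepancy) auto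
    show "has_bochner_integral lborel (\<lambda>z. 2 * C\<^sup>2 * ((Sa z)\<^sup>2 + (Sb z)\<^sup>2)) (2 * C\<^sup>2 * (?Ra + ?Rb))"
      by (intro has_bochner_integral_mult_right has_bochner_integral_add Sa Sb)
    show "(gauss_discrepancy (x ` I) t z)\<^sup>2 \<le> 2 * C\<^sup>2 * ((Sa z)\<^sup>2 + (Sb z)\<^sup>2)" for z
    proof -
      have "(gauss_discrepancy (x ` I) t z)\<^sup>2 \<le> (C * (Sa z + Sb z))\<^sup>2"
        using disc[of z] by (metis abs_ge_zero power2_abs power_mono)
      also have "\<dots> \<le> C\<^sup>2 * (2 * ((Sa z)\<^sup>2 + (Sb z)\<^sup>2))"
        unfolding power_mult_distrib using sum_squares_bound[of "Sa z" "Sb z"]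
        by (intro mult_left_mono) (auto simp: power2_sum)
      finally show ?thesis by (simp add: algebra_simps)
    qed
  qed
  also have "?Ra \<le> exp (A / 2) * t * G'"
  proof -
    \<comment> \<open>Each term is at most \<open>exp (A / 2)\<close> times the cell average of the
      wider Gaussian with parameter \<open>t / 4\<close>: squared distances at most double, and
      \<open>t\<close> times the squared cell radius is at most \<open>A\<close>. The cell averages
      then sum to \<open>n\<close> times a spherical mean.\<close>
    have "(\<Sum>j\<in>I. exp (- (t / 2) * (norm (x i - x j))\<^sup>2)) \<le> exp (A / 2) * (n * (1 / t))" if i: "i \<in> I" for i
    proof -
      define g where "g y = exp (- (t / 4) * (norm (x i - y))\<^sup>2)" for y
      have gc: "continuous_on UNIV g" unfolding g_def by (intro continuous_intros)
      have "exp (- (t / 2) * (norm (x i - x j))\<^sup>2) * exp (- A / 2) \<le> \<Lambda> j g" if j: "j \<in> I" for j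
      proof (rule sphere_cell.lower[OF cell[OF j] gc])
        fix y assume "y \<in> K j"
        from sphere_cell.dist[OF cell[OF j] this]
        have "t * (norm (y - x j))\<^sup>2 \<le> n * (A / n)"
          using tn t n A by (intro mult_mono) (auto simp: n_def)
        then have d: "t * (norm (y - x j))\<^sup>2 \<le> A" using n by simp
        have "(norm (x i - y))\<^sup>2 \<le> (norm (x i - x j) + norm (y - x j))\<^sup>2"
          using norm_triangle_ineq4[of "x i - x j" "y - x j"] by (intro power_mono) auto
        also have "\<dots> \<le> 2 * (norm (x i - x j))\<^sup>2 + 2 * (norm (y - x j))\<^sup>2"
          using sum_squares_bound[of "norm (x i - x j)" "norm (y - x j)"] by (simp add: power2_sum)
        finally have "(t / 4) * (norm (x i - y))\<^sup>2 \<le> (t / 4) * (2 * (norm (x i - x j))\<^sup>2 + 2 * (norm (y - x j))\<^sup>2)"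
          using t by (intro mult_left_mono) auto
        then have "- (t / 2) * (norm (x i - x j))\<^sup>2 + - A / 2 \<le> - (t / 4) * (norm (x i - y))\<^sup>2"
          using d by (simp add: algebra_simps)
        then show "exp (- (t / 2) * (norm (x i - x j))\<^sup>2) * exp (- A / 2) \<le> g y"
          unfolding g_def exp_add[symmetric] by (rule exp_mono)
      qed
      then have "(\<Sum>j\<in>I. exp (- (t / 2) * (norm (x i - x j))\<^sup>2) * exp (- A / 2)) \<le> (\<Sum>j\<in>I. \<Lambda> j g)"
        by (rule sum_mono)
      also have "\<dots> = n * gauss_mean (t / 4)"
        using integral_S2_prob_gaussian[of "t / 4" "x i"] t unit[OF i]
        by (simp add: part[OF gc] n_def gauss_mean_def g_def)
      also have "\<dots> \<le> n * (1 / t)"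
        using gauss_mean_le[of "t / 4"] t n by (intro mult_left_mono) auto
      finally have "exp (A / 2) * ((\<Sum>j\<in>I. exp (- (t / 2) * (norm (x i - x j))\<^sup>2)) * exp (- A / 2)) \<le> exp (A / 2) * (n * (1 / t))"
        by (intro mult_left_mono) (auto simp: sum_distrib_right)
      then show ?thesis by (simp add: exp_minus field_simps)
    qed
    then have "(\<Sum>i\<in>I. \<Sum>j\<in>I. exp (- (t / 2) * (norm (x i - x j))\<^sup>2)) \<le> (\<Sum>i\<in>I. exp (A / 2) * (n * (1 / t)))"
      by (rule sum_mono)
    also have "\<dots> = exp (A / 2) * (n * (n * (1 / t)))" by (simp add: n_def)
    finally have "((t / n)\<^sup>2 * G') * (\<Sum>i\<in>I. \<Sum>j\<in>I. exp (- (t / 2) * (norm (x i - x j))\<^sup>2))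
       \<le> ((t / n)\<^sup>2 * G') * (exp (A / 2) * (n * (n * (1 / t))))"
      using t by (intro mult_left_mono) (auto simp: G'_def)
    also have "\<dots> = exp (A / 2) * t * G'"
      using t n by (simp add: power2_eq_square)
    finally show ?thesis by (simp add: sum_distrib_left mult_ac)
  qed
  also have "?Rb \<le> L\<^sup>2 * t * G'"
  proof -
    have "?Rb \<le> (\<Sum>i\<in>I. \<Sum>j\<in>I. (t / n\<^sup>2 * (1 / \<rho> i * (1 / \<rho> j))) * (1 * G'))"
      using t n \<rho> by (intro sum_mono mult_left_mono mult_right_mono) (auto simp: G'_def less_imp_le)
    also have "\<dots> = t / n\<^sup>2 * G' * ((\<Sum>i\<in>I. 1 / \<rho> i) * (\<Sum>j\<in>I. 1 / \<rho> j))"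
      unfolding sum_product by (simp only: sum_distrib_left) (intro sum.cong refl, simp)
    also have "\<dots> \<le> t / n\<^sup>2 * G' * ((L * n) * (L * n))"
      using sum t n \<rho> sum_nonneg[of I "\<lambda>i. 1 / \<rho> i"]
      by (intro mult_left_mono mult_mono) (auto simp: G'_def n_def less_imp_le)
    also have "\<dots> = L\<^sup>2 * t * G'" using n by (simp add: power2_eq_square)
    finally show ?thesis .
  qed
  finally have "G * gauss_energy (x ` I) t \<le> 2 * C\<^sup>2 * (exp (A / 2) * t * G' + L\<^sup>2 * t * G')"
    by (simp add: mult_left_mono)
  also have "\<dots> = (2 * C\<^sup>2 * (exp (A / 2) + L\<^sup>2) * t) * G'" by (simp add: algebra_simps)
  \<comment> \<open>The ratio of \<open>G'\<close> to \<open>G\<close> is \<open>sqrt 2 ^ 3\<close>,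
    which is at most 3; hence the factor 6.\<close>
  also have "\<dots> \<le> (2 * C\<^sup>2 * (exp (A / 2) + L\<^sup>2) * t) * (3 * G)"
  proof (rule mult_left_mono)
    have "sqrt (pi / (2 * t)) = sqrt 2 * sqrt (pi / (4 * t))" by (simp flip: real_sqrt_mult)
    then have "G' = sqrt 2 ^ 3 * G" by (simp add: G'_def G_def power_mult_distrib)
    moreover have "sqrt 2 ^ 3 \<le> 3"
    proof -
      have "sqrt 2 \<le> 3 / 2" by (rule real_le_lsqrt) (auto simp: power2_eq_square)
      then show ?thesis by (simp add: power3_eq_cube)
    qed
    moreover have "0 \<le> G" using t by (simp add: G_def)
    ultimately show "G' \<le> 3 * G" by (simp add: mult_right_mono)
  qed (use t in simp)
  finally have "gauss_energy (x ` I) t * G \<le> (6 * C\<^sup>2 * (exp (A / 2) + L\<^sup>2) * t) * G" by (simp add: mult_ac)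
  moreover have "0 < G" using t by (simp add: G_def)
  ultimately show ?thesis by (simp add: C_def)
qed

section \<open>Rectangles in spherical coordinates\<close>

lemma integral_box_mult:
  fixes F G :: "real \<Rightarrow> real"
  assumes "continuous_on UNIV F" "continuous_on UNIV G"
  shows "integral (cbox (a, c) (b, d)) (\<lambda>p. F (fst p) * G (snd p)) = integral {a..b} F * integral {c..d} G"
  by (subst integral_prod_continuous)
     (auto intro!: continuous_on_mult continuous_on_compose2[OF assms(1)] continuous_on_compose2[OF assms(2)]
        continuous_on_fst continuous_on_snd continuous_on_id)

lemma one_minus_cos_le: "1 - cos x \<le> x\<^sup>2 / 2" for x :: real
proof -
  have "\<bar>sin (x / 2)\<bar>\<^sup>2 \<le> \<bar>x / 2\<bar>\<^sup>2" by (intro power_mono abs_sin_x_le_abs_x) auto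
  then show ?thesis using cos_double_sin[of "x / 2"] by (simp add: power_divide)
qed

text \<open>Separates the displacement along a meridian from that along a parallel, so that the two
  can be estimated independently.\<close>

lemma norm_S2_chart_diff:
  "(norm (S2_chart (s, \<phi>) - S2_chart (s0, \<phi>0)))\<^sup>2 =
    (cos s - cos s0)\<^sup>2 + (sin s - sin s0)\<^sup>2 + 2 * sin s * sin s0 * (1 - cos (\<phi> - \<phi>0))"
proof -
  have "(cos s - cos s0)\<^sup>2 + (sin s - sin s0)\<^sup>2 =
     ((sin s)\<^sup>2 + (cos s)\<^sup>2) + ((sin s0)\<^sup>2 + (cos s0)\<^sup>2) - 2 * cos s * cos s0 - 2 * sin s * sin s0"
    by (simp only: power2_diff)
  then show ?thesis
    by (simp add: norm_diff_sphere norm_S2_chart inner_S2_chart sin_cos_squared_add cos_diff[of \<phi> \<phi>0] cos_diff[of \<phi>0 \<phi>] algebra_simps)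
qed

lemma integral_sin_Icc: "a \<le> b \<Longrightarrow> integral {a..b} sin = cos a - cos b" for a b :: real
  using fundamental_theorem_of_calculus[of a b "\<lambda>x. - cos x" sin]
  by (auto simp: integral_unique has_real_derivative_iff_has_vector_derivative[symmetric]
      intro!: derivative_eq_intros)

lemma integral_sin_diff_symmetric: "0 \<le> d \<Longrightarrow> integral {c - d..c + d} (\<lambda>x. sin (x - c)) = 0" for c d :: real
proof -
  assume "0 \<le> d"
  then have "((\<lambda>x. sin (x - c)) has_integral (- cos ((c + d) - c)) - (- cos ((c - d) - c))) {c - d..c + d}"
    by (intro fundamental_theorem_of_calculus)
       (auto simp: has_real_derivative_iff_has_vector_derivative[symmetric] intro!: derivative_eq_intros)
  then show ?thesis by (simp add: integral_unique)
qed

lemma integral_cos_mult_sin_Icc: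
  fixes a b :: real assumes "a \<le> b"
  shows "integral {a..b} (\<lambda>x. cos x * sin x) = ((cos a)\<^sup>2 - (cos b)\<^sup>2) / 2"
proof -
  have "((\<lambda>x. cos x * sin x) has_integral (- (cos b)\<^sup>2 / 2) - (- (cos a)\<^sup>2 / 2)) {a..b}"
    using assms by (intro fundamental_theorem_of_calculus)
      (auto simp: has_real_derivative_iff_has_vector_derivative[symmetric] intro!: derivative_eq_intros)
  then show ?thesis by (simp add: integral_unique diff_divide_distrib)
qed

text \<open>The content is the centroid bound. Area is uniform in the height, so the mean height is
  that of the two bounding parallels, namely \<open>h\<close>; displacements along the parallel
  cancel by reflection in the meridian \<open>\<phi>\<close>. Only the curvature of the sphere in
  the radial direction remains, of size \<open>d / (2 * \<rho>)\<close>.\<close>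

lemma sphere_cell_rectangle:
  fixes a b h \<phi> \<delta> w d :: real
  assumes ab: "0 \<le> a" "a \<le> b" "b \<le> pi" and \<delta>: "0 \<le> \<delta>" and h: "cos a + cos b = 2 * h" "\<bar>h\<bar> < 1"
    and w: "w * (2 * \<delta> * (cos a - cos b)) = 1" "w \<ge> 0"
    and K: "K = S2_chart ` cbox (a, \<phi> - \<delta>) (b, \<phi> + \<delta>)" and x: "x = S2_chart (arccos h, \<phi>)"
    and dist: "\<And>y. y \<in> K \<Longrightarrow> (norm (y - x))\<^sup>2 \<le> d"
  shows "sphere_cell (\<lambda>g. w * integral (cbox (a, \<phi> - \<delta>) (b, \<phi> + \<delta>)) (\<lambda>p. g (S2_chart p) * sin (fst p)))
    K x d (d / (2 * sqrt (1 - h\<^sup>2)))"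
proof -
  define R where "R = cbox (a, \<phi> - \<delta>) (b, \<phi> + \<delta>)"
  define \<Lambda> where "\<Lambda> g = w * integral R (\<lambda>p. g (S2_chart p) * sin (fst p))" for g :: "real^3 \<Rightarrow> real"
  define \<rho> where "\<rho> = sqrt (1 - h\<^sup>2)"
  have \<rho>: "\<rho> > 0" "\<rho>\<^sup>2 = 1 - h\<^sup>2" using h(2) by (auto simp: \<rho>_def abs_square_less_1 abs_square_le_1)
  have int: "(\<lambda>p. g (S2_chart p) * sin (fst p)) integrable_on R" if "continuous_on UNIV g" for g :: "real^3 \<Rightarrow> real"
    unfolding R_def by (intro integrable_continuous continuous_intros continuous_on_compose2[OF that] subset_UNIV)
  have sin0: "0 \<le> sin (fst p)" if "p \<in> R" for p
    using that ab by (cases p) (auto simp: R_def cbox_Pair_eq intro!: sin_ge_zero)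
  have mass: "w * integral R (\<lambda>p. B * sin (fst p)) = B" for B
  proof -
    have "integral R (\<lambda>p. B * sin (fst p)) = integral {a..b} (\<lambda>s. B * sin s) * integral {\<phi> - \<delta>..\<phi> + \<delta>} (\<lambda>_. 1 :: real)"
      unfolding R_def
      using integral_box_mult[of "\<lambda>s. B * sin s" "\<lambda>_. 1" a "\<phi> - \<delta>" b "\<phi> + \<delta>"] by (simp add: continuous_intros)
    also have "\<dots> = B * (2 * \<delta> * (cos a - cos b))"
      using ab \<delta> by (simp add: integral_sin_Icc)
    finally have "w * integral R (\<lambda>p. B * sin (fst p)) = B * (w * (2 * \<delta> * (cos a - cos b)))"
      by (simp only: mult.left_commute)
    then show ?thesis by (simp only: w(1) mult_1_right)
  qed
  have add: "\<Lambda> (\<lambda>y. g y + k y) = \<Lambda> g + \<Lambda> k" if "continuous_on UNIV g" "continuous_on UNIV k" for g k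
    using integral_add[OF int int, OF that] by (simp add: \<Lambda>_def distrib_right distrib_left)
  have scale: "\<Lambda> (\<lambda>y. c * g y) = c * \<Lambda> g" for c g
    by (simp add: \<Lambda>_def mult.assoc)
  have upper: "\<Lambda> g \<le> B" if g: "continuous_on UNIV g" "\<And>y. y \<in> K \<Longrightarrow> g y \<le> B" for g B
  proof -
    have "integral R (\<lambda>p. g (S2_chart p) * sin (fst p)) \<le> integral R (\<lambda>p. B * sin (fst p))"
      using g(2) by (intro integral_le int g(1) int[of "\<lambda>_. B"] continuous_intros mult_right_mono sin0)
        (auto simp: K R_def)
    from mult_left_mono[OF this w(2)] show ?thesis by (simp only: \<Lambda>_def mass)
  qed
  have moment: "\<bar>\<Lambda> (\<lambda>y. p \<bullet> (y - x))\<bar> \<le> norm p * (d / (2 * \<rho>))" for p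
  proof -
    \<comment> \<open>The horizontal unit vectors at azimuth \<open>\<phi>\<close>, pointing away
      from the axis and along the parallel.\<close>
    define e e' :: "real^3" where "e = vector [cos \<phi>, sin \<phi>, 0]" and "e' = vector [- sin \<phi>, cos \<phi>, 0]"
    \<comment> \<open>The vertical coefficient corrected by the height-linear part of the radial
      displacement; thus \<open>k\<close> collects all of \<open>p \<bullet> (y - x)\<close> that
      averages to 0.\<close>
    define c where "c = p $ 3 - (p \<bullet> e) * h / \<rho>"
    define k where "k y = c * (y $ 3 - h) + (p \<bullet> e') * (e' \<bullet> y)" for y
    have ne: "norm e = 1" by (simp add: e_def norm_vector3)
    have kc: "continuous_on UNIV k" unfolding k_def by (intro continuous_intros)
    have lc: "continuous_on UNIV (\<lambda>y. p \<bullet> (y - x))" by (intro continuous_intros)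
    have sx: "sin (arccos h) = \<rho>" "cos (arccos h) = h"
      using h(2) by (auto simp: \<rho>_def sin_arccos_abs cos_arccos)
    have near: "\<bar>p \<bullet> (y - x) - k y\<bar> \<le> norm p * (d / (2 * \<rho>))" if y: "y \<in> K" for y
    proof -
      obtain s t where st: "y = S2_chart (s, t)" using y K by auto
      \<comment> \<open>On the sphere the radial displacement is linear in the height up to a multiple of \<open>|y - x|^2\<close>,
        and the linear part averages to \<open>0\<close>.\<close>
      have "(norm (y - x))\<^sup>2 = 2 - 2 * (\<rho> * (sin s * cos (t - \<phi>)) + h * cos s)"
        unfolding st x by (subst norm_diff_sphere)
          (simp_all only: norm_S2_chart inner_commute[of "S2_chart (s, t)"], simp add: inner_S2_chart sx)
      then have "\<rho> * (sin s * cos (t - \<phi>) - \<rho>) = - h * (cos s - h) - (norm (y - x))\<^sup>2 / 2"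
        using \<rho>(2) by (simp add: algebra_simps power2_eq_square)
      then have "sin s * cos (t - \<phi>) - \<rho> = (- h * (cos s - h) - (norm (y - x))\<^sup>2 / 2) / \<rho>"
        using \<rho>(1) by (metis less_irrefl nonzero_mult_div_cancel_left)
      then have rad: "sin s * cos (t - \<phi>) - \<rho> = - h / \<rho> * (cos s - h) - (norm (y - x))\<^sup>2 / (2 * \<rho>)"
        by (simp add: diff_divide_distrib)
      have ortho: "p \<bullet> y - p \<bullet> x = (p \<bullet> e) * (sin s * cos (t - \<phi>) - \<rho>) + (p \<bullet> e') * (sin s * sin (t - \<phi>)) + p $ 3 * (cos s - h)"
      proof -
        have t1: "cos t = cos \<phi> * cos (t - \<phi>) - sin \<phi> * sin (t - \<phi>)"
          and t2: "sin t = sin \<phi> * cos (t - \<phi>) + cos \<phi> * sin (t - \<phi>)"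
          using cos_add[of \<phi> "t - \<phi>"] sin_add[of \<phi> "t - \<phi>"] by simp_all
        have "p \<bullet> y - p \<bullet> x = p $ 1 * (sin s * cos t - \<rho> * cos \<phi>) + p $ 2 * (sin s * sin t - \<rho> * sin \<phi>) + p $ 3 * (cos s - h)"
          by (simp add: st x S2_chart_def inner_vec_def sum_3 vector_3 sx right_diff_distrib)
        also have "\<dots> = (p $ 1 * cos \<phi> + p $ 2 * sin \<phi>) * (sin s * cos (t - \<phi>) - \<rho>) +
            (- p $ 1 * sin \<phi> + p $ 2 * cos \<phi>) * (sin s * sin (t - \<phi>)) + p $ 3 * (cos s - h)"
          unfolding t1 t2 by (simp add: algebra_simps)
        finally show ?thesis
          by (simp add: inner_vec_def sum_3 vector_3 e_def e'_def)
      qed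
      have e'y: "e' \<bullet> y = sin s * sin (t - \<phi>)"
        by (simp add: st S2_chart_def inner_vec_def sum_3 vector_3 e'_def sin_diff algebra_simps)
      have y3: "y $ 3 = cos s" by (simp add: st S2_chart_def vector_3)
      have "p \<bullet> (y - x) - k y = (p \<bullet> e) * (- h / \<rho> * (cos s - h) - (norm (y - x))\<^sup>2 / (2 * \<rho>)) + (p \<bullet> e) * h / \<rho> * (cos s - h)"
        unfolding k_def e'y y3 inner_diff_right ortho rad c_def by (simp add: algebra_simps)
      also have "\<dots> = - ((p \<bullet> e) * ((norm (y - x))\<^sup>2 / (2 * \<rho>)))"
        by (simp add: algebra_simps flip: add_divide_distrib)
      finally have "\<bar>p \<bullet> (y - x) - k y\<bar> = \<bar>p \<bullet> e\<bar> * ((norm (y - x))\<^sup>2 / (2 * \<rho>))"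
        using \<rho>(1) by (simp add: abs_mult)
      also have "\<dots> \<le> norm p * (d / (2 * \<rho>))"
        using Cauchy_Schwarz_ineq2[of p e] ne dist[OF y] \<rho>(1) by (intro mult_mono divide_right_mono) auto
      finally show ?thesis .
    qed
    have "\<Lambda> k = 0"
    proof -
      have 1: "integral R (\<lambda>q. (cos (fst q) - h) * sin (fst q)) = 0"
      proof -
        have "integral R (\<lambda>q. (cos (fst q) - h) * sin (fst q)) = integral {a..b} (\<lambda>s. (cos s - h) * sin s) * (2 * \<delta>)"
          unfolding R_def using \<delta>
            integral_box_mult[of "\<lambda>s. (cos s - h) * sin s" "\<lambda>_. 1" a "\<phi> - \<delta>" b "\<phi> + \<delta>"] by (simp add: continuous_intros)
        also have "integral {a..b} (\<lambda>s. (cos s - h) * sin s) = integral {a..b} (\<lambda>s. cos s * sin s) - integral {a..b} (\<lambda>s. h * sin s)"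
          unfolding left_diff_distrib
          by (rule integral_diff) (intro integrable_continuous_real continuous_intros)+
        also have "\<dots> = ((cos a)\<^sup>2 - (cos b)\<^sup>2) / 2 - h * (cos a - cos b)"
          using ab by (simp add: integral_cos_mult_sin_Icc integral_sin_Icc)
        also have "\<dots> = (cos a - cos b) * ((cos a + cos b) / 2 - h)"
          by (simp add: power2_eq_square algebra_simps diff_divide_distrib)
        also have "\<dots> = 0" by (simp add: h(1))
        finally show ?thesis by simp
      qed
      have 2: "integral R (\<lambda>q. (e' \<bullet> S2_chart q) * sin (fst q)) = 0"
      proof -
        have "(\<lambda>q. (e' \<bullet> S2_chart q) * sin (fst q)) = (\<lambda>q. (sin (fst q) * sin (fst q)) * sin (snd q - \<phi>))"
          by (auto simp: S2_chart_def inner_vec_def sum_3 vector_3 e'_def sin_diff algebra_simps)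
        then show ?thesis
          unfolding R_def using \<delta> integral_sin_diff_symmetric[of \<delta> \<phi>]
            integral_box_mult[of "\<lambda>s. sin s * sin s" "\<lambda>t. sin (t - \<phi>)" a "\<phi> - \<delta>" b "\<phi> + \<delta>"]
          by (simp add: continuous_intros)
      qed
      have "\<Lambda> k = c * \<Lambda> (\<lambda>y. y $ 3 - h) + (p \<bullet> e') * \<Lambda> (\<lambda>y. e' \<bullet> y)"
        unfolding k_def by (subst add) (auto intro!: continuous_intros simp: scale)
      then show ?thesis
        using 1 2 by (simp add: \<Lambda>_def S2_chart_def[of q for q] vector_3)
    qed
    have "\<Lambda> (\<lambda>y. p \<bullet> (y - x)) = \<Lambda> (\<lambda>y. p \<bullet> (y - x) + (- 1) * k y)"
      using add[OF lc, of "\<lambda>y. (- 1) * k y"] scale[of "- 1" k] \<open>\<Lambda> k = 0\<close> kc by (simp add: continuous_intros)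
    also have "\<bar>\<dots>\<bar> \<le> norm p * (d / (2 * \<rho>))"
    proof -
      have c1: "continuous_on UNIV (\<lambda>y. p \<bullet> (y - x) + (- 1) * k y)" by (intro continuous_intros kc)
      have c2: "continuous_on UNIV (\<lambda>y. (- 1) * (p \<bullet> (y - x) + (- 1) * k y))" by (intro continuous_intros kc)
      have "\<Lambda> (\<lambda>y. p \<bullet> (y - x) + (- 1) * k y) \<le> norm p * (d / (2 * \<rho>))"
        by (rule upper[OF c1]) (use near in \<open>force simp: abs_le_iff\<close>)
      moreover have "\<Lambda> (\<lambda>y. (- 1) * (p \<bullet> (y - x) + (- 1) * k y)) \<le> norm p * (d / (2 * \<rho>))"
        by (rule upper[OF c2]) (use near in \<open>force simp: abs_le_iff\<close>)
      ultimately show ?thesis unfolding scale by linarith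
    qed
    finally show ?thesis .
  qed
  have "sphere_cell \<Lambda> K x d (d / (2 * \<rho>))"
    by unfold_locales (use moment in \<open>simp_all add: add scale upper dist\<close>)
  then show ?thesis by (simp add: \<Lambda>_def[abs_def] R_def \<rho>_def)
qed

section \<open>The rings of the Diamond ensemble\<close>

lemma sum_integral_consecutive:
  fixes f :: "real \<Rightarrow> real" and c :: "nat \<Rightarrow> real"
  assumes "continuous_on UNIV f" "\<And>k. k < n \<Longrightarrow> c k \<le> c (Suc k)"
  shows "(\<Sum>k<n. integral {c k..c (Suc k)} f) = integral {c 0..c n} f"
  using assms(2)
proof (induction n)
  case (Suc n)
  have "c 0 \<le> c m" if "m \<le> n" for m using that
  proof (induction m)
    case (Suc m) then show ?case using Suc.prems \<open>\<And>k. k < Suc n \<Longrightarrow> c k \<le> c (Suc k)\<close>[of m] by auto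
  qed simp
  then have "c 0 \<le> c n" by simp
  moreover have "f integrable_on {c 0..c (Suc n)}"
    by (intro integrable_continuous_real continuous_on_subset[OF assms(1)]) auto
  ultimately show ?case
    using Suc.IH Suc.prems by (simp add: Henstock_Kurzweil_Integration.integral_combine)
qed simp

lemma integral_periodic_shift:
  fixes f :: "real \<Rightarrow> real"
  assumes f: "continuous_on UNIV f" "\<And>x. f (x + p) = f x" and d: "0 \<le> d" "d \<le> p"
  shows "integral {- d..p - d} f = integral {0..p} f"
proof -
  have int: "f integrable_on {a..b}" for a b
    by (intro integrable_continuous_real continuous_on_subset[OF f(1)]) auto
  have "f \<circ> (+) p = f" using f(2) by (auto simp: add.commute)
  then have "integral {- d..0} f = integral {p - d..p} f"
    using integral_shift_Icc_real[of "- d" 0 f p] by (simp add: add.commute)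
  moreover have "integral {- d..0} f + integral {0..p - d} f = integral {- d..p - d} f"
    using d by (intro Henstock_Kurzweil_Integration.integral_combine int) auto
  moreover have "integral {0..p - d} f + integral {p - d..p} f = integral {0..p} f"
    using d by (intro Henstock_Kurzweil_Integration.integral_combine int) auto
  ultimately show ?thesis by simp
qed

lemma sum_integral_arcs:
  fixes f :: "real \<Rightarrow> real" and r :: nat
  assumes f: "continuous_on UNIV f" "\<And>x. f (x + 2 * pi) = f x" and r: "r > 0"
  shows "(\<Sum>l<r. integral {2 * pi * real l / real r - pi / real r..2 * pi * real l / real r + pi / real r} f)
      = integral {0..2 * pi} f"
proof -
  \<comment> \<open>The left end of the arc around the point number \<open>l\<close>. The arcs tile
    one period that starts at \<open>- pi / r\<close> instead of 0.\<close>
  define c where "c l = (2 * real l - 1) * pi / real r" for l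
  have "{2 * pi * real l / real r - pi / real r..2 * pi * real l / real r + pi / real r} = {c l..c (Suc l)}" for l
    using r by (simp add: c_def field_simps)
  then have "(\<Sum>l<r. integral {2 * pi * real l / real r - pi / real r..2 * pi * real l / real r + pi / real r} f)
      = (\<Sum>l<r. integral {c l..c (Suc l)} f)" by simp
  also have "\<dots> = integral {c 0..c r} f"
    by (intro sum_integral_consecutive f(1)) (auto simp: c_def divide_right_mono)
  also have "{c 0..c r} = {- (pi / real r)..2 * pi - pi / real r}"
    using r by (simp add: c_def field_simps)
  also have "integral \<dots> f = integral {0..2 * pi} f"
  proof (rule integral_periodic_shift[OF f])
    have "pi / real r \<le> pi / 1" using r by (intro divide_left_mono) auto
    then show "pi / real r \<le> 2 * pi" using pi_gt_zero by linarith
  qed simp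
  finally show ?thesis .
qed

section \<open>Heights of the ring boundaries\<close>

text \<open>The height of the parallel just below ring \<open>j\<close>. Area is proportional to
  height, so the band between the levels \<open>j - 1\<close> and \<open>j\<close> has the share
  \<open>diamond_r N j / N\<close> of the sphere.\<close>

definition ring_level :: "nat \<Rightarrow> nat \<Rightarrow> real" where
  "ring_level N j = 1 - 2 / real N * (\<Sum>k = 1..j. real (diamond_r N k))"

lemma ring_level_0: "ring_level N 0 = 1"
  by (simp add: ring_level_def)

lemma ring_level_last: assumes "N \<ge> 4" shows "ring_level N (2 * diamond_M N - 1) = - 1"
proof -
  have "(\<Sum>k = 1..2 * diamond_M N - 1. real (diamond_r N k)) = real N"
    using arg_cong[OF sum_diamond_r[OF assms], of real] by simp
  then show ?thesis using assms by (simp add: ring_level_def)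
qed

lemma ring_level_Suc: "ring_level N (Suc j) = ring_level N j - 2 * real (diamond_r N (Suc j)) / real N"
  by (simp add: ring_level_def algebra_simps)

lemma ring_level_antimono: "i \<le> j \<Longrightarrow> ring_level N j \<le> ring_level N i"
  by (rule lift_Suc_antimono_le[of "ring_level N"]) (simp_all add: ring_level_Suc)

lemma ring_level_bounds:
  assumes "N \<ge> 4" "j \<le> 2 * diamond_M N - 1" shows "- 1 \<le> ring_level N j" "ring_level N j \<le> 1"
  using ring_level_antimono[OF assms(2), of N] ring_level_antimono[of 0 j N] ring_level_last[OF assms(1)] ring_level_0[of N]
  by simp_all

text \<open>Places the points of a ring halfway in height between its two boundary parallels, as the
  centroid argument requires.\<close>

lemma diamond_h_eq_ring_level:
  "diamond_h N (Suc j) = ring_level N j - real (diamond_r N (Suc j)) / real N"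
  by (simp add: diamond_h_def ring_level_def atLeastLessThanSuc_atLeastAtMost)

lemma diamond_rho_pos:
  assumes "N \<ge> 4" "j \<in> {1..2 * diamond_M N - 1}"
  shows "0 < diamond_rho N j" "(diamond_rho N j)\<^sup>2 = 1 - (diamond_h N j)\<^sup>2" "diamond_rho N j \<le> 1"
  using diamond_h_bound[OF assms] by (auto simp: diamond_rho_def abs_square_less_1 abs_square_le_1)

lemma ring_level_upper:
  assumes "j < diamond_M N" shows "ring_level N j = 1 - 4 * real j * (real j + 1) / real N"
proof -
  have "(\<Sum>k = 1..j. real (diamond_r N k)) = (\<Sum>k = 1..j. 4 * real k)"
    using assms by (intro sum.cong) (auto simp: diamond_r_def Let_def)
  also have "\<dots> = 2 * real j * (real j + 1)"
    by (induction j) (auto simp: algebra_simps)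
  finally show ?thesis by (simp add: ring_level_def)
qed

text \<open>Climbs \<open>i\<close> rings from the south pole; the rings passed have sizes 4, 8, and
  so on up to \<open>4 * i\<close>.\<close>

lemma ring_level_lower:
  assumes "N \<ge> 4" "i < diamond_M N"
  shows "ring_level N (2 * diamond_M N - 1 - i) = - 1 + 4 * real i * (real i + 1) / real N"
  using assms(2)
proof (induction i)
  case 0 then show ?case using ring_level_last[OF assms(1)] by simp
next
  case (Suc i)
  define M where "M = diamond_M N"
  have e: "2 * M - 1 - i = Suc (2 * M - 1 - Suc i)" using Suc.prems by (simp add: M_def)
  have "diamond_r N (2 * M - 1 - i) = 4 * Suc i"
    using Suc.prems by (auto simp: diamond_r_def Let_def M_def[symmetric])
  then have "ring_level N (2 * M - 1 - i) = ring_level N (2 * M - 1 - Suc i) - 8 * real (Suc i) / real N"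
    unfolding e ring_level_Suc by simp
  moreover have "ring_level N (2 * M - 1 - i) = - 1 + 4 * real i * (real i + 1) / real N"
    using Suc by (simp add: M_def)
  ultimately have "ring_level N (2 * M - 1 - Suc i) = - 1 + (4 * real i * (real i + 1) + 8 * real (Suc i)) / real N"
    by (simp add: add_divide_distrib)
  also have "4 * real i * (real i + 1) + 8 * real (Suc i) = 4 * real (Suc i) * (real (Suc i) + 1)"
    by (simp add: algebra_simps)
  finally show ?case by (simp add: M_def)
qed

section \<open>Sizes and radii of the rings\<close>

text \<open>Indexes the rings of both hemispheres by their rank \<open>i\<close> from the nearer
  pole, so that one estimate serves both. The equatorial ring has its own size and is treated
  separately.\<close>

lemma diamond_ring_cases:
  assumes N: "N \<ge> 4" and j: "j \<in> {1..2 * diamond_M N - 1}" "j \<noteq> diamond_M N"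
  obtains i where "1 \<le> i" "i < diamond_M N" "diamond_r N j = 4 * i" "\<bar>diamond_h N j\<bar> = 1 - 4 * (real i)\<^sup>2 / real N"
proof -
  define M where "M = diamond_M N"
  \<comment> \<open>Makes \<open>1 - 4 * (real i)\<^sup>2 / real N\<close> nonnegative, hence equal
    to the absolute value of the height.\<close>
  have le1: "4 * (real i)\<^sup>2 / real N \<le> 1" if "i < M" for i
  proof -
    have "4 * i\<^sup>2 \<le> 4 * M\<^sup>2" using that by (simp add: power_mono)
    also have "\<dots> \<le> N" using diamond_M_square_le by (simp add: M_def)
    finally have "real (4 * i\<^sup>2) \<le> real N" by (rule of_nat_mono)
    then show ?thesis using N by (simp add: divide_le_eq)
  qed
  consider "j < M" | "j > M" using j(2) by (metis M_def linorder_neqE_nat)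
  then show ?thesis
  proof cases
    case 1
    then obtain i where i: "j = Suc i" "i < M" using j(1) by (cases j) auto
    have r: "diamond_r N j = 4 * j" using 1 by (simp add: diamond_r_def M_def Let_def)
    have "diamond_h N j = 1 - 4 * (real j)\<^sup>2 / real N"
      unfolding i(1) diamond_h_eq_ring_level r[unfolded i(1)] using ring_level_upper[of i N] i(2) N
      by (simp add: M_def power2_eq_square field_simps)
    then show ?thesis using that[of j] 1 j r le1[OF 1] by (simp add: M_def)
  next
    case 2
    define i where "i = 2 * M - j"
    have i: "1 \<le> i" "i < M" using 2 j(1) by (auto simp: i_def M_def)
    then obtain i' where i': "i = Suc i'" by (cases i) auto
    have j_eq: "j = Suc (2 * M - 1 - i)" "2 * M - 1 - i < 2 * M" using i 2 by (auto simp: i_def)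
    have r: "diamond_r N j = 4 * i" using 2 by (simp add: diamond_r_def M_def Let_def i_def)
    have "diamond_h N j = - 1 + 4 * real i * (real i + 1) / real N - 4 * real i / real N"
      using diamond_h_eq_ring_level[of N "2 * M - 1 - i"] ring_level_lower[OF N, of i] i r j_eq(1)
      by (simp add: M_def)
    then have "diamond_h N j = - (1 - 4 * (real i)\<^sup>2 / real N)"
      by (simp add: power2_eq_square algebra_simps add_divide_distrib)
    then show ?thesis using that[of i] i r le1[OF i(2)] by (simp add: M_def)
  qed
qed

lemma diamond_M_bounds:
  assumes "N \<ge> 4"
  shows "2 * real (diamond_M N) \<le> sqrt (real N)" "sqrt (real N) < 2 * real (diamond_M N) + 2"
proof -
  have s: "sqrt (real N / 4) = sqrt (real N) / 2" by (simp add: real_sqrt_divide)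
  have "0 \<le> \<lfloor>sqrt (real N / 4)\<rfloor>" by simp
  then have "real (diamond_M N) = of_int \<lfloor>sqrt (real N / 4)\<rfloor>" unfolding diamond_M_def by simp
  then show "2 * real (diamond_M N) \<le> sqrt (real N)" "sqrt (real N) < 2 * real (diamond_M N) + 2"
    unfolding s by linarith+
qed

text \<open>The equatorial ring takes the remainder \<open>N - (4 * M\<^sup>2 - 4 * M)\<close>. Its
  size is of order \<open>sqrt N\<close> because \<open>N\<close> lies between
  \<open>4 * M\<^sup>2\<close> and \<open>4 * (M + 1)\<^sup>2\<close>.\<close>

lemma diamond_equator:
  assumes N: "N \<ge> 4"
  shows "diamond_h N (diamond_M N) = 0" "sqrt (real N) \<le> real (diamond_r N (diamond_M N))"
    "real (diamond_r N (diamond_M N)) \<le> 8 * sqrt (real N)"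
proof -
  define M where "M = diamond_M N"
  have M1: "M \<ge> 1" using diamond_M_ge_1[OF N] by (simp add: M_def)
  then obtain m where m: "M = Suc m" by (cases M) auto
  have "2 * (\<Sum>k = 1..<M. 4 * k) + 4 * M = 4 * M\<^sup>2" using sum_cap[of M] by linarith
  then have c: "2 * real (\<Sum>k = 1..<M. 4 * k) = 4 * (real M)\<^sup>2 - 4 * real M"
    by (metis (no_types, opaque_lifting) add_diff_cancel_right' of_nat_add of_nat_mult of_nat_numeral of_nat_power)
  have "diamond_r N M = N - 2 * (\<Sum>k = 1..<M. 4 * k)" by (simp add: diamond_r_def M_def)
  then have r: "real (diamond_r N M) = real N - (4 * (real M)\<^sup>2 - 4 * real M)"
    using twice_sum_cap_less[OF N] c by (simp add: M_def of_nat_diff)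
  have "ring_level N m = 1 - 4 * real m * (real m + 1) / real N"
    by (rule ring_level_upper) (use m in \<open>simp add: M_def\<close>)
  then have "diamond_h N M = 1 - (4 * real m * (real m + 1) + real (diamond_r N M)) / real N"
    unfolding m diamond_h_eq_ring_level by (simp add: add_divide_distrib)
  also have "4 * real m * (real m + 1) + real (diamond_r N M) = real N"
  proof -
    have rm: "real m = real M - 1" by (simp add: m)
    show ?thesis unfolding r rm by (simp add: power2_eq_square algebra_simps)
  qed
  finally show "diamond_h N (diamond_M N) = 0" using N by (simp add: M_def)
  define s where "s = sqrt (real N)"
  have s: "2 * real M \<le> s" "s < 2 * real M + 2" "s\<^sup>2 = real N"
    using diamond_M_bounds[OF N] by (auto simp: s_def M_def)
  have "2 \<le> s" using s(1) M1 by linarith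
  \<comment> \<open>So the ring has at least \<open>4 * M\<close> points, and
    \<open>4 * M \<ge> 2 * M + 2 > s\<close>.\<close>
  have "4 * (real M)\<^sup>2 \<le> s\<^sup>2" using power_mono[OF s(1), of 2] by (simp add: power_mult_distrib)
  then show "sqrt (real N) \<le> real (diamond_r N (diamond_M N))"
    using r s M1 by (simp add: M_def[symmetric] s_def[symmetric])
  have "s\<^sup>2 \<le> (2 * real M + 2)\<^sup>2" using s \<open>2 \<le> s\<close> by (intro power_mono) auto
  then have "real N \<le> 4 * (real M)\<^sup>2 + 8 * real M + 4" unfolding s(3)[symmetric] by (simp add: power2_eq_square algebra_simps)
  \<comment> \<open>Here \<open>12 * M \<le> 6 * s\<close> and \<open>4 \<le> 2 * s\<close>.\<close>
  then have "real (diamond_r N M) \<le> 12 * real M + 4" using r by linarith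
  then show "real (diamond_r N (diamond_M N)) \<le> 8 * sqrt (real N)"
    using s(1) \<open>2 \<le> s\<close> M1 by (simp add: M_def[symmetric] s_def[symmetric])
qed

text \<open>The spacing of the points along every parallel is comparable to
  \<open>1 / sqrt N\<close>. Off the equator,
  \<open>N * \<rho>\<^sup>2 = 4 * i\<^sup>2 * (2 - u)\<close> with \<open>2 - u\<close> between 1
  and 2, against \<open>16 * i\<^sup>2\<close> for the squared ring size; the constant 8 comes from
  the equator.\<close>

lemma diamond_r_rho_bounds:
  assumes N: "N \<ge> 4" and j: "j \<in> {1..2 * diamond_M N - 1}"
  shows "sqrt (real N) * diamond_rho N j \<le> real (diamond_r N j)"
    and "real (diamond_r N j) \<le> 8 * sqrt (real N) * diamond_rho N j"
proof -
  have "sqrt (real N) * diamond_rho N j \<le> real (diamond_r N j) \<and>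
    real (diamond_r N j) \<le> 8 * sqrt (real N) * diamond_rho N j"
  proof (cases "j = diamond_M N")
    case True
    then have "diamond_rho N j = 1" using diamond_equator(1)[OF N] by (simp add: diamond_rho_def)
    then show ?thesis using diamond_equator(2,3)[OF N] True by simp
  next
    case False
    from diamond_ring_cases[OF N j False] obtain i where i: "1 \<le> i" "diamond_r N j = 4 * i"
      "\<bar>diamond_h N j\<bar> = 1 - 4 * (real i)\<^sup>2 / real N" by metis
    define u where "u = 4 * (real i)\<^sup>2 / real N"
    have u: "0 \<le> u" "u \<le> 1" using i(3) by (auto simp: u_def)
    have "(diamond_h N j)\<^sup>2 = (1 - u)\<^sup>2" using i(3) by (metis power2_abs u_def)
    then have rho: "(diamond_rho N j)\<^sup>2 = u * (2 - u)"
      using diamond_rho_pos(2)[OF N j] by (simp add: power2_eq_square algebra_simps)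
    have Nu: "real N * u = 4 * (real i)\<^sup>2" using N by (simp add: u_def)
    have sq: "(sqrt (real N) * diamond_rho N j)\<^sup>2 = 4 * (real i)\<^sup>2 * (2 - u)"
      using rho Nu by (simp add: power_mult_distrib flip: mult.assoc)
    have "(sqrt (real N) * diamond_rho N j)\<^sup>2 \<le> (real (diamond_r N j))\<^sup>2"
      unfolding sq using u mult_left_mono[of "2 - u" 4 "4 * (real i)\<^sup>2"] by (simp add: i(2) power_mult_distrib)
    then have 1: "sqrt (real N) * diamond_rho N j \<le> real (diamond_r N j)"
      by (rule power2_le_imp_le) simp
    have "(real (diamond_r N j))\<^sup>2 \<le> (8 * (sqrt (real N) * diamond_rho N j))\<^sup>2"
      unfolding power_mult_distrib[of 8] sq using u mult_left_mono[of 1 "16 * (2 - u)" "(real i)\<^sup>2"]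
      by (simp add: i(2) power_mult_distrib algebra_simps)
    then have "real (diamond_r N j) \<le> 8 * (sqrt (real N) * diamond_rho N j)"
      by (rule power2_le_imp_le) (use diamond_rho_pos(1)[OF N j] in simp)
    with 1 show ?thesis by simp
  qed
  then show "sqrt (real N) * diamond_rho N j \<le> real (diamond_r N j)"
    "real (diamond_r N j) \<le> 8 * sqrt (real N) * diamond_rho N j" by auto
qed

section \<open>The Diamond cells\<close>

definition diamond_azimuth :: "nat \<Rightarrow> nat \<Rightarrow> nat \<Rightarrow> real" where
  "diamond_azimuth N j l = 2 * pi * real l / real (diamond_r N j)"

text \<open>Every cell has area \<open>4 * pi / N\<close>, whence the prefactor. The arc of
  \<open>l = 0\<close> starts at a negative azimuth, which is harmless because the chart is
  periodic.\<close>

definition diamond_cell_average :: "nat \<Rightarrow> nat \<Rightarrow> nat \<Rightarrow> (real^3 \<Rightarrow> real) \<Rightarrow> real" where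
  "diamond_cell_average N j l g = real N / (4 * pi) *
     integral (cbox (arccos (ring_level N (j - 1)), diamond_azimuth N j l - pi / real (diamond_r N j))
                    (arccos (ring_level N j), diamond_azimuth N j l + pi / real (diamond_r N j)))
       (\<lambda>p. g (S2_chart p) * sin (fst p))"

definition diamond_cell :: "nat \<Rightarrow> nat \<Rightarrow> nat \<Rightarrow> (real^3) set" where
  "diamond_cell N j l = S2_chart `
     cbox (arccos (ring_level N (j - 1)), diamond_azimuth N j l - pi / real (diamond_r N j))
          (arccos (ring_level N j), diamond_azimuth N j l + pi / real (diamond_r N j))"

lemma diamond_point_eq_chart:
  assumes "N \<ge> 4" "j \<in> {1..2 * diamond_M N - 1}"
  shows "diamond_point N j l = S2_chart (arccos (diamond_h N j), diamond_azimuth N j l)"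
  using diamond_h_bound[OF assms]
  by (simp add: diamond_point_def S2_chart_def diamond_azimuth_def diamond_rho_def sin_arccos_abs cos_arccos)

text \<open>With \<open>q = 1 / sqrt N\<close>, the displacements in height, in distance from the
  axis and along the parallel are all of order \<open>q\<close>; near the poles this rests on the
  ring size being comparable to \<open>\<rho> / q\<close>.\<close>

lemma diamond_cell_dist:
  assumes N: "N \<ge> 4" and j: "j \<in> {1..2 * diamond_M N - 1}" and y: "y \<in> diamond_cell N j l"
  shows "(norm (y - diamond_point N j l))\<^sup>2 \<le> 600 / real N"
proof -
  define h where "h = diamond_h N j"
  define \<rho> where "\<rho> = diamond_rho N j"
  define r where "r = real (diamond_r N j)"
  define q where "q = 1 / sqrt (real N)"
  have q: "q > 0" "q\<^sup>2 = 1 / real N" "q * q * real N = 1" using N by (auto simp: q_def power_divide)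
  have r1: "1 \<le> r" using diamond_r_pos[OF N j] by (simp add: r_def)
  have \<rho>: "0 < \<rho>" "\<rho>\<^sup>2 = 1 - h\<^sup>2" "\<rho> \<le> 1" using diamond_rho_pos[OF N j] by (auto simp: \<rho>_def h_def)
  have hb: "\<bar>h\<bar> < 1" using diamond_h_bound[OF N j] by (simp add: h_def)
  have \<rho>r: "\<rho> \<le> q * r" and r\<rho>: "r * q \<le> 8 * \<rho>"
    using diamond_r_rho_bounds[OF N j] N by (auto simp: q_def r_def \<rho>_def field_simps)
  obtain s t where st: "y = S2_chart (s, t)" "arccos (ring_level N (j - 1)) \<le> s" "s \<le> arccos (ring_level N j)"
    "\<bar>t - diamond_azimuth N j l\<bar> \<le> pi / r"
    using y by (auto simp: diamond_cell_def cbox_Pair_eq r_def abs_le_iff)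
  have jS: "j = Suc (j - 1)" and j1: "j \<le> 2 * diamond_M N - 1" "j - 1 \<le> 2 * diamond_M N - 1" using j by auto
  have levb: "\<bar>ring_level N (j - 1)\<bar> \<le> 1" "\<bar>ring_level N j\<bar> \<le> 1"
    using ring_level_bounds[OF N j1(1)] ring_level_bounds[OF N j1(2)] by (simp_all only: abs_le_iff minus_le_iff)
  have lev: "ring_level N (j - 1) = h + r / real N" "ring_level N j = h - r / real N"
    using diamond_h_eq_ring_level[of N "j - 1"] ring_level_Suc[of N "j - 1"] jS by (auto simp: h_def r_def)
  have s: "0 \<le> s" "s \<le> pi"
    using st(2,3) arccos_lbound[of "ring_level N (j - 1)"] arccos_ubound[of "ring_level N j"] levb by (auto simp: abs_le_iff)
  have "cos s \<le> ring_level N (j - 1)" "ring_level N j \<le> cos s"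
    using cos_mono_le_eq[of s "arccos (ring_level N (j - 1))"] cos_mono_le_eq[of "arccos (ring_level N j)" s] s st(2,3) levb
    by (auto simp: abs_le_iff arccos_lbound arccos_ubound cos_arccos)
  then have "\<bar>cos s - h\<bar> \<le> r / real N" unfolding lev by (simp add: abs_le_iff)
  also have "r / real N = (r * q) * q" using q N by (simp add: field_simps power2_eq_square)
  also have "\<dots> \<le> 8 * \<rho> * q" using r\<rho> q by (intro mult_right_mono) auto
  finally have c: "\<bar>cos s - h\<bar> \<le> 8 * \<rho> * q" .
  also have "\<dots> \<le> 8 * 1 * q" using \<rho> q by (intro mult_right_mono mult_left_mono) auto
  finally have c1: "\<bar>cos s - h\<bar> \<le> 8 * q" by simp
  have sin0: "0 \<le> sin s" using s by (rule sin_ge_zero)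
  have d: "\<bar>sin s - \<rho>\<bar> \<le> 16 * q"
  proof -
    \<comment> \<open>The bound on \<open>cos s - h\<close> contains the factor
      \<open>\<rho>\<close>, so the difference of the squares of \<open>sin s\<close> and
      \<open>\<rho>\<close> can be divided by \<open>\<rho>\<close> without loss near the
      poles.\<close>
    have c2: "\<bar>cos s + h\<bar> \<le> 2" using hb abs_cos_le_one[of s] by linarith
    have "\<bar>sin s - \<rho>\<bar> * \<rho> \<le> \<bar>sin s - \<rho>\<bar> * (sin s + \<rho>)" using sin0 by (intro mult_left_mono) auto
    also have "\<dots> = \<bar>(sin s - \<rho>) * (sin s + \<rho>)\<bar>" using sin0 \<rho> by (simp add: abs_mult)
    also have "(sin s - \<rho>) * (sin s + \<rho>) = - ((cos s - h) * (cos s + h))"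
      using \<rho>(2) sin_squared_eq[of s] by (simp add: power2_eq_square algebra_simps)
    also have "\<bar>- ((cos s - h) * (cos s + h))\<bar> \<le> (8 * \<rho> * q) * 2"
      unfolding abs_minus_cancel abs_mult
      using c \<rho> q c2 by (intro mult_mono) auto
    finally have "\<bar>sin s - \<rho>\<bar> * \<rho> \<le> (16 * q) * \<rho>" by (simp add: mult_ac)
    then show ?thesis using \<rho>(1) by simp
  qed
  have e: "2 * sin s * \<rho> * (1 - cos (t - diamond_azimuth N j l)) \<le> 272 * q\<^sup>2"
  proof -
    have "(t - diamond_azimuth N j l)\<^sup>2 \<le> (pi / r)\<^sup>2"
      using power_mono[OF st(4), of 2] by simp
    also have "\<dots> \<le> (4 / r)\<^sup>2" using pi_less_4 r1 by (intro power_mono divide_right_mono) auto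
    finally have "1 - cos (t - diamond_azimuth N j l) \<le> (4 / r)\<^sup>2 / 2"
      using one_minus_cos_le[of "t - diamond_azimuth N j l"] by linarith
    then have "2 * sin s * \<rho> * (1 - cos (t - diamond_azimuth N j l)) \<le> 2 * sin s * \<rho> * ((4 / r)\<^sup>2 / 2)"
      using sin0 \<rho> by (intro mult_left_mono) auto
    also have "\<dots> = 16 * (sin s / r) * (\<rho> / r)" using r1 by (simp add: power2_eq_square)
    also have "\<dots> \<le> 16 * (17 * q) * q"
    proof (intro mult_mono)
      show "\<rho> / r \<le> q" using \<rho>r r1 by (simp add: divide_le_eq)
      have "sin s \<le> q * r + 16 * q * 1" using d \<rho>r by linarith
      also have "\<dots> \<le> q * r + 16 * q * r" using r1 q by (intro add_left_mono mult_left_mono) auto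
      finally show "sin s / r \<le> 17 * q" using r1 by (simp add: divide_le_eq)
    qed (use sin0 r1 \<rho> q in auto)
    finally show ?thesis by (simp add: power2_eq_square)
  qed
  have sx: "sin (arccos h) = \<rho>" "cos (arccos h) = h"
    using hb by (auto simp: \<rho>_def diamond_rho_def h_def sin_arccos_abs cos_arccos)
  have "(norm (y - diamond_point N j l))\<^sup>2 =
      (cos s - h)\<^sup>2 + (sin s - \<rho>)\<^sup>2 + 2 * sin s * \<rho> * (1 - cos (t - diamond_azimuth N j l))"
    unfolding diamond_point_eq_chart[OF N j] st(1) norm_S2_chart_diff h_def[symmetric] sx by simp
  \<comment> \<open>The three contributions add up to \<open>592 * q\<^sup>2\<close>.\<close>
  also have "\<dots> \<le> (8 * q)\<^sup>2 + (16 * q)\<^sup>2 + 272 * q\<^sup>2"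
    using power_mono[OF c1, of 2] power_mono[OF d, of 2] by (intro add_mono e) simp_all
  also have "\<dots> \<le> 600 / real N" using q N by (simp add: power_mult_distrib divide_right_mono)
  finally show ?thesis .
qed

text \<open>The last parameter is written to match \<open>A / (card I * \<rho> i)\<close> of the
  energy estimate, with \<open>A = 600\<close> and \<open>\<rho>\<close> twice the ring
  radius.\<close>

lemma sphere_cell_diamond:
  assumes N: "N \<ge> 4" and j: "j \<in> {1..2 * diamond_M N - 1}"
  shows "sphere_cell (diamond_cell_average N j l) (diamond_cell N j l) (diamond_point N j l)
    (600 / real N) (600 / (real N * (2 * diamond_rho N j)))"
proof -
  define r where "r = real (diamond_r N j)"
  have r: "r > 0" using diamond_r_pos[OF N j] by (simp add: r_def)
  have jS: "j = Suc (j - 1)" and j1: "j \<le> 2 * diamond_M N - 1" "j - 1 \<le> 2 * diamond_M N - 1" using j by auto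
  have levb: "- 1 \<le> ring_level N (j - 1)" "ring_level N (j - 1) \<le> 1" "- 1 \<le> ring_level N j" "ring_level N j \<le> 1"
    using ring_level_bounds[OF N j1(1)] ring_level_bounds[OF N j1(2)] by simp_all
  have lev: "ring_level N (j - 1) = diamond_h N j + r / real N" "ring_level N j = diamond_h N j - r / real N"
    using diamond_h_eq_ring_level[of N "j - 1"] ring_level_Suc[of N "j - 1"] jS by (auto simp: r_def)
  have "sphere_cell (diamond_cell_average N j l) (diamond_cell N j l) (diamond_point N j l)
    (600 / real N) ((600 / real N) / (2 * sqrt (1 - (diamond_h N j)\<^sup>2)))"
    unfolding diamond_cell_average_def[abs_def]
  proof (rule sphere_cell_rectangle)
    show "0 \<le> arccos (ring_level N (j - 1))" "arccos (ring_level N j) \<le> pi"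
      using levb by (auto intro: arccos_lbound arccos_ubound)
    show "arccos (ring_level N (j - 1)) \<le> arccos (ring_level N j)"
      using levb by (intro arccos_le_arccos ring_level_antimono) auto
    show "cos (arccos (ring_level N (j - 1))) + cos (arccos (ring_level N j)) = 2 * diamond_h N j"
      unfolding cos_arccos[OF levb(1,2)] cos_arccos[OF levb(3,4)] unfolding lev by simp
    show "real N / (4 * pi) * (2 * (pi / real (diamond_r N j)) *
        (cos (arccos (ring_level N (j - 1))) - cos (arccos (ring_level N j)))) = 1"
      unfolding cos_arccos[OF levb(1,2)] cos_arccos[OF levb(3,4)] unfolding lev r_def[symmetric]
      using r N by (simp add: field_simps)
    show "\<bar>diamond_h N j\<bar> < 1" by (rule diamond_h_bound[OF N j])
    show "diamond_cell N j l = S2_chart ` cbox (arccos (ring_level N (j - 1)), diamond_azimuth N j l - pi / real (diamond_r N j))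
          (arccos (ring_level N j), diamond_azimuth N j l + pi / real (diamond_r N j))"
      by (rule diamond_cell_def)
    show "diamond_point N j l = S2_chart (arccos (diamond_h N j), diamond_azimuth N j l)"
      by (rule diamond_point_eq_chart[OF N j])
    show "(norm (y - diamond_point N j l))\<^sup>2 \<le> 600 / real N" if "y \<in> diamond_cell N j l" for y
      by (rule diamond_cell_dist[OF N j that])
  qed (use r in \<open>auto simp: r_def\<close>)
  then show ?thesis by (simp add: diamond_rho_def mult.assoc)
qed

text \<open>The arcs of a ring tile a full period of the azimuth, and the polar angles of the levels
  run from 0 to \<open>pi\<close>, so the cells tile the whole coordinate box.\<close>

lemma sum_diamond_cell_average:
  assumes N: "N \<ge> 4" and g: "continuous_on UNIV g"
  shows "(\<Sum>j = 1..2 * diamond_M N - 1. \<Sum>l<diamond_r N j. diamond_cell_average N j l g) =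
    real N * (\<integral>y. g y \<partial>S2_prob)"
proof -
  define F where "F p = g (S2_chart p) * sin (fst p)" for p
  have F: "continuous_on A F" for A
    unfolding F_def by (intro continuous_intros continuous_on_compose2[OF g] subset_UNIV)
  define T where "T s = integral {0..2 * pi} (\<lambda>t. F (s, t))" for s
  have T: "continuous_on UNIV T"
    unfolding T_def box_real[symmetric]
    by (rule integral_continuous_on_param) (auto simp: split_beta intro!: F)
  have Fs: "continuous_on UNIV (\<lambda>t. F (s, t))" for s
    by (rule continuous_on_compose2[OF F[of UNIV]]) (auto intro!: continuous_intros)
  define I where "I j l = {diamond_azimuth N j l - pi / real (diamond_r N j)..diamond_azimuth N j l + pi / real (diamond_r N j)}" for j l
  have ring: "(\<Sum>l<diamond_r N j. diamond_cell_average N j l g) =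
      real N / (4 * pi) * integral {arccos (ring_level N (j - 1))..arccos (ring_level N j)} T"
    if j: "j \<in> {1..2 * diamond_M N - 1}" for j
  proof -
    define S where "S = {arccos (ring_level N (j - 1))..arccos (ring_level N j)}"
    have "(\<Sum>l<diamond_r N j. diamond_cell_average N j l g) =
      (\<Sum>l<diamond_r N j. real N / (4 * pi) * integral S (\<lambda>s. integral (I j l) (\<lambda>t. F (s, t))))"
      unfolding diamond_cell_average_def F_def[symmetric] integral_prod_continuous[OF F] box_real S_def I_def ..
    also have "\<dots> = real N / (4 * pi) * (\<Sum>l<diamond_r N j. integral S (\<lambda>s. integral (I j l) (\<lambda>t. F (s, t))))"
      by (rule sum_distrib_left[symmetric])
    also have "(\<Sum>l<diamond_r N j. integral S (\<lambda>s. integral (I j l) (\<lambda>t. F (s, t)))) =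
        integral S (\<lambda>s. \<Sum>l<diamond_r N j. integral (I j l) (\<lambda>t. F (s, t)))"
    proof (rule integral_sum[symmetric])
      show "(\<lambda>s. integral (I j l) (\<lambda>t. F (s, t))) integrable_on S" for l
        unfolding S_def I_def box_real[symmetric]
        by (intro integrable_continuous integral_continuous_on_param) (auto simp: split_beta intro!: F)
    qed simp
    also have "(\<lambda>s. \<Sum>l<diamond_r N j. integral (I j l) (\<lambda>t. F (s, t))) = T"
      unfolding T_def I_def diamond_azimuth_def
      by (rule ext, rule sum_integral_arcs[OF Fs _ diamond_r_pos[OF N j]]) (simp add: F_def S2_chart_def)
    finally show ?thesis by (simp add: S_def)
  qed
  define n where "n = 2 * diamond_M N - 1"
  have "(\<Sum>j = 1..n. \<Sum>l<diamond_r N j. diamond_cell_average N j l g) =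
    (\<Sum>j = 1..n. real N / (4 * pi) * integral {arccos (ring_level N (j - 1))..arccos (ring_level N j)} T)"
    by (intro sum.cong refl ring) (simp add: n_def)
  also have "\<dots> = real N / (4 * pi) * (\<Sum>j = 1..n. integral {arccos (ring_level N (j - 1))..arccos (ring_level N j)} T)"
    by (rule sum_distrib_left[symmetric])
  also have "(\<Sum>j = 1..n. integral {arccos (ring_level N (j - 1))..arccos (ring_level N j)} T) =
     (\<Sum>k<n. integral {arccos (ring_level N k)..arccos (ring_level N (Suc k))} T)"
    by (rule sum.reindex_bij_witness[of _ Suc "\<lambda>j. j - 1"]) auto
  also have "\<dots> = integral {arccos (ring_level N 0)..arccos (ring_level N n)} T"
  proof (rule sum_integral_consecutive[OF T])
    fix k assume "k < n"
    then show "arccos (ring_level N k) \<le> arccos (ring_level N (Suc k))"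
      using ring_level_bounds[OF N, of k] ring_level_bounds[OF N, of "Suc k"]
      by (intro arccos_le_arccos ring_level_antimono) (auto simp: n_def)
  qed
  also have "{arccos (ring_level N 0)..arccos (ring_level N n)} = {0..pi}"
    using ring_level_last[OF N] by (simp add: ring_level_0 n_def)
  also have "integral {0..pi} T = integral (cbox (0, 0) (pi, 2 * pi)) F"
    unfolding T_def by (subst integral_prod_continuous[OF F]) simp
  also have "real N / (4 * pi) * \<dots> = real N * (\<integral>y. g y \<partial>S2_prob)"
    unfolding integral_S2_prob[OF g] F_def by simp
  finally show ?thesis by (simp add: n_def)
qed

section \<open>Linear bound for the Gaussian energy of the Diamond points\<close>

lemma gauss_energy_diamond_le:
  obtains C :: real where "C \<ge> 0"
    "\<And>N t. N \<ge> 4 \<Longrightarrow> 0 < t \<Longrightarrow> t \<le> real N \<Longrightarrow> gauss_energy (diamond_points N) t \<le> C * t"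
proof
  \<comment> \<open>The constant of the cell estimate for \<open>A = 600\<close> and
    \<open>L = 4\<close>.\<close>
  define C :: real where "C = 6 * (32 * 600\<^sup>2 * exp (10 * 600) + 4 * 600)\<^sup>2 * (exp (600 / 2) + 4\<^sup>2)"
  show "C \<ge> 0" by (simp add: C_def)
  fix N :: nat and t :: real assume N: "N \<ge> 4" and t: "0 < t" "t \<le> real N"
  define J where "J = {1..2 * diamond_M N - 1}"
  define I where "I = (SIGMA j:J. {..<diamond_r N j})"
  define x where "x = (\<lambda>(j, l). diamond_point N j l)"
  have P: "diamond_points N = x ` I"
    by (auto simp: diamond_points_def I_def J_def x_def image_iff) blast+
  have cardI: "card I = N" using sum_diamond_r[OF N] by (simp add: I_def J_def card_SigmaI)
  have fin: "finite I" by (auto simp: I_def J_def)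
  \<comment> \<open>The index set and its image both have \<open>N\<close> elements.\<close>
  have inj: "inj_on x I"
    using card_diamond_points[OF N] cardI fin unfolding P by (intro eq_card_imp_inj_on) auto
  have "gauss_energy (x ` I) t \<le> 6 * (32 * 600\<^sup>2 * exp (10 * 600) + 4 * 600)\<^sup>2 * (exp (600 / 2) + 4\<^sup>2) * t"
  proof (rule gauss_energy_le_of_cells[OF fin _ inj, where \<rho> = "\<lambda>(j, l). 2 * diamond_rho N j"])
    show "I \<noteq> {}" using cardI N by auto
    show "x ` I \<subseteq> sphere 0 1" using diamond_points_subset_sphere[OF N] P by simp
    show "sphere_cell ((\<lambda>(j, l). diamond_cell_average N j l) i) ((\<lambda>(j, l). diamond_cell N j l) i) (x i)
        (600 / real (card I)) (600 / (real (card I) * (\<lambda>(j, l). 2 * diamond_rho N j) i))" if iI: "i \<in> I" for i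
    proof -
      obtain j l where i: "i = (j, l)" "j \<in> {1..2 * diamond_M N - 1}"
        using iI by (auto simp: I_def J_def)
      show ?thesis unfolding i(1) x_def cardI prod.case by (rule sphere_cell_diamond[OF N i(2)])
    qed
    show "(\<Sum>i\<in>I. (\<lambda>(j, l). diamond_cell_average N j l) i g) = real (card I) * (\<integral>y. g y \<partial>S2_prob)"
      if "continuous_on UNIV g" for g
    proof -
      have "(\<Sum>i\<in>I. (\<lambda>(j, l). diamond_cell_average N j l) i g) =
          (\<Sum>j\<in>J. \<Sum>l<diamond_r N j. diamond_cell_average N j l g)"
        unfolding I_def by (subst sum.Sigma) (auto simp: J_def split_beta)
      then show ?thesis using sum_diamond_cell_average[OF N that] by (simp only: J_def cardI)
    qed
    show "(\<lambda>(j, l). 2 * diamond_rho N j) i > 0" if "i \<in> I" for i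
      using that diamond_rho_pos(1)[OF N] by (auto simp: I_def J_def)
    \<comment> \<open>Every ring contributes at most \<open>4 * sqrt N\<close>, since its size is at
      most \<open>8 * sqrt N\<close> times its radius, and there are at most \<open>sqrt N\<close>
      rings.\<close>
    show "(\<Sum>i\<in>I. 1 / (\<lambda>(j, l). 2 * diamond_rho N j) i) \<le> 4 * real (card I)"
    proof -
      have "(\<Sum>i\<in>I. 1 / (\<lambda>(j, l). 2 * diamond_rho N j) i) = (\<Sum>j\<in>J. \<Sum>l<diamond_r N j. 1 / (2 * diamond_rho N j))"
        unfolding I_def by (subst sum.Sigma) (auto simp: J_def split_beta)
      also have "\<dots> \<le> (\<Sum>j\<in>J. 4 * sqrt (real N))"
      proof (rule sum_mono)
        fix j assume j: "j \<in> J"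
        have "0 < diamond_rho N j" "real (diamond_r N j) \<le> 8 * sqrt (real N) * diamond_rho N j"
          using diamond_rho_pos(1)[OF N] diamond_r_rho_bounds(2)[OF N] j by (auto simp: J_def)
        then show "(\<Sum>l<diamond_r N j. 1 / (2 * diamond_rho N j)) \<le> 4 * sqrt (real N)"
          by (simp add: divide_le_eq)
      qed
      also have "\<dots> \<le> (2 * real (diamond_M N)) * (4 * sqrt (real N))"
      proof -
        have "real (card J) \<le> 2 * real (diamond_M N)" by (simp add: J_def)
        then show ?thesis unfolding sum_constant by (intro mult_right_mono) auto
      qed
      also have "\<dots> \<le> sqrt (real N) * (4 * sqrt (real N))"
        using diamond_M_bounds[OF N] by (intro mult_right_mono) auto
      also have "\<dots> = 4 * real (card I)" by (simp add: cardI)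
      finally show ?thesis .
    qed
  qed (use t cardI in auto)
  then show "gauss_energy (diamond_points N) t \<le> C * t" by (simp add: P C_def)
qed

theorem theorem1:
  fixes \<alpha> :: real
  assumes "0 < \<alpha>" and "\<alpha> < 2"
  shows "mean_distance_power \<alpha> = 2 powr (\<alpha> + 1) / (\<alpha> + 2) \<and>
    (\<exists>C>0. \<forall>N::nat. N \<ge> 4 \<longrightarrow>
       diamond_points N \<subseteq> sphere 0 1 \<and> card (diamond_points N) = N \<and>
       0 \<le> mean_distance_power \<alpha> * (real N)\<^sup>2
             - (\<Sum>x\<in>diamond_points N. \<Sum>y\<in>diamond_points N. norm (x - y) powr \<alpha>) \<and>
       mean_distance_power \<alpha> * (real N)\<^sup>2
             - (\<Sum>x\<in>diamond_points N. \<Sum>y\<in>diamond_points N. norm (x - y) powr \<alpha>)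
         \<le> C * real N powr (1 - \<alpha> / 2))"
proof -
  obtain C :: real where C: "C \<ge> 0"
    "\<And>N t. N \<ge> 4 \<Longrightarrow> 0 < t \<Longrightarrow> t \<le> real N \<Longrightarrow> gauss_energy (diamond_points N) t \<le> C * t"
    by (rule gauss_energy_diamond_le) blast
  have half: "0 < \<alpha> / 2" "\<alpha> / 2 < 1" using assms by auto
  obtain D where D: "D > 0"
    "\<And>P. \<lbrakk>finite P; P \<subseteq> sphere 0 1; P \<noteq> {}; \<And>t::real. 0 < t \<Longrightarrow> t \<le> card P \<Longrightarrow> gauss_energy P t \<le> C * t\<rbrakk> \<Longrightarrow>
      0 \<le> 4 powr (\<alpha> / 2) / (\<alpha> / 2 + 1) * (real (card P))\<^sup>2 - (\<Sum>x\<in>P. \<Sum>y\<in>P. ((norm (x - y))\<^sup>2) powr (\<alpha> / 2)) \<and>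
      4 powr (\<alpha> / 2) / (\<alpha> / 2 + 1) * (real (card P))\<^sup>2 - (\<Sum>x\<in>P. \<Sum>y\<in>P. ((norm (x - y))\<^sup>2) powr (\<alpha> / 2))
        \<le> D * real (card P) powr (1 - \<alpha> / 2)"
    by (rule energy_deficit_bounds[OF half C(1)]) blast
  have mean: "mean_distance_power \<alpha> = 4 powr (\<alpha> / 2) / (\<alpha> / 2 + 1)"
    by (rule mean_distance_power_eq[OF assms])
  have "4 powr (\<alpha> / 2) = (2 powr 2) powr (\<alpha> / 2)" by simp
  also have "\<dots> = 2 powr \<alpha>" unfolding powr_powr by simp
  finally have "4 powr (\<alpha> / 2) / (\<alpha> / 2 + 1) = 2 powr (\<alpha> + 1) / (\<alpha> + 2)"
    using assms by (simp add: powr_add field_simps)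
  moreover have "diamond_points N \<subseteq> sphere 0 1 \<and> card (diamond_points N) = N \<and>
       0 \<le> mean_distance_power \<alpha> * (real N)\<^sup>2
             - (\<Sum>x\<in>diamond_points N. \<Sum>y\<in>diamond_points N. norm (x - y) powr \<alpha>) \<and>
       mean_distance_power \<alpha> * (real N)\<^sup>2
             - (\<Sum>x\<in>diamond_points N. \<Sum>y\<in>diamond_points N. norm (x - y) powr \<alpha>)
         \<le> D * real N powr (1 - \<alpha> / 2)" if N: "N \<ge> 4" for N :: nat
  proof -
    have card: "card (diamond_points N) = N" by (rule card_diamond_points[OF N])
    then have "finite (diamond_points N)" "diamond_points N \<noteq> {}"
      using N by (auto intro: card_ge_0_finite)
    from D(2)[OF this(1) diamond_points_subset_sphere[OF N] this(2)] C(2)[OF N] diamond_points_subset_sphere[OF N]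
    show ?thesis unfolding card mean powr_norm_eq by auto
  qed
  ultimately show ?thesis using D(1) mean by metis
qed

end
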